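(* Let $r=r(n)$ be an integer-valued function with $2\le r=o(\sqrt{\ln\ln n})$ as $n\to\infty$, and let $C_r:=2^{8r^2}$. Suppose that $p_1,\dots,p_r$ are functions of $n$ such that $0\le p_1\le p_2\le\dots\le p_r\le 1$, and let $\mathbf{G}=\mathbf{G}(n,p_1,p_2,\dots,p_r)$ be the $r$-fold binomial random graph. For $i\in[r]$ let $P_i:=p_1p_2\cdots p_i$. Then: (i) if $P_i\le \frac{1}{C_r\, n(\ln n)^{i-1}}$ for some $2\le i\le r$, or $P_1\le \frac{\ln n}{C_r n}$, then with high probability $\mathbf{G}$ does not percolate; (ii) if $P_i\ge \frac{C_r}{n(\ln n)^{i-1}}$ for every $2\le i\le r$, and $P_1\ge \frac{C_r\ln n}{n}$, then with high probability $\mathbf{G}$ percolates.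
   Context: Write $[n]=\{1,\dots,n\}$. The number of colours $r$ is allowed to depend on $n$ (constant $r$ is included). An $r$-fold graph is an $(r+1)$-tuple $\mathbf{G}=(V,E_1,\dots,E_r)$ where $V=[n]$ is the vertex set and $E_i\subseteq\binom{V}{2}$ for each $i\in[r]$; the graph $(V,E_i)$ is the graph of colour $i$. The $r$-fold binomial random graph $\mathbf{G}(n,p_1,\dots,p_r)$ is the random $r$-fold graph $([n],E_1,\dots,E_r)$ where $([n],E_i)\sim G(n,p_i)$, $i\in[r]$, are independent binomial (Erdős–Rényi) random graphs. Multi-coloured jigsaw algorithm on an $r$-fold graph $(V,E_1,\dots,E_r)$: start with the partition $\mathcal{C}_0$ of $V$ into singletons (clusters). Given the partition $\mathcal{C}_t$ at time $t\ge0$, let $H_t$ be the graph with vertex set $\mathcal{C}_t$ in which two distinct clusters $C,C'$ are joined if for every colour $s\in[r]$ there is an edge of $E_s$ with one endpoint in $C$ and the other in $C'$. If $H_t$ has no edges, stop. Otherwise $\mathcal{C}_{t+1}$ is obtained by merging all the clusters in each connected component of $H_t$ into one cluster. If $|\mathcal{C}_{t+1}|=1$, stop; otherwise continue. The $r$-fold graph percolates if the algorithm ends with one single cluster, and does not percolate otherwise. "With high probability" means with probability tending to $1$ as $n\to\infty$. *)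

theory Defs
  imports "HOL-Probability.Probability" "HOL-Library.Landau_Symbols"
begin

definition vertex_pairs :: "nat set \<Rightarrow> nat set set" where
  "vertex_pairs V = {e. e \<subseteq> V \<and> card e = 2}"

text \<open>An \<open>r\<close>-fold graph on a vertex set \<open>V\<close> is given by the function \<open>E\<close> that maps each colour
  \<open>s \<in> {1..r}\<close> to its edge set \<open>E s \<subseteq> vertex_pairs V\<close>; values of \<open>E\<close> at other arguments
  are irrelevant.\<close>

definition clusters_joined :: "nat \<Rightarrow> (nat \<Rightarrow> nat set set) \<Rightarrow> nat set \<Rightarrow> nat set \<Rightarrow> bool" where
  "clusters_joined r E C D \<longleftrightarrow>
     C \<noteq> D \<and> (\<forall>s\<in>{1..r}. \<exists>u\<in>C. \<exists>v\<in>D. {u, v} \<in> E s)"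

definition cluster_graph ::
  "nat \<Rightarrow> (nat \<Rightarrow> nat set set) \<Rightarrow> nat set set \<Rightarrow> (nat set \<times> nat set) set" where
  "cluster_graph r E P = {(C, D). C \<in> P \<and> D \<in> P \<and> clusters_joined r E C D}"

text \<open>The classes of \<open>P\<close> under the reflexive transitive closure of the (symmetric) adjacency
  relation are the connected components of the cluster graph. Once the algorithm has stopped, the
  partition is kept unchanged; a one-cluster partition has no edges in its cluster graph, so this
  also covers stopping at a single cluster.\<close>

definition jigsaw_step :: "nat \<Rightarrow> (nat \<Rightarrow> nat set set) \<Rightarrow> nat set set \<Rightarrow> nat set set" where
  "jigsaw_step r E P =
     (if cluster_graph r E P = {} then P
      else \<Union> ` (P // (cluster_graph r E P)\<^sup>*))"

fun jigsaw :: "nat set \<Rightarrow> nat \<Rightarrow> (nat \<Rightarrow> nat set set) \<Rightarrow> nat \<Rightarrow> nat set set" where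
  "jigsaw V r E 0 = (\<lambda>v. {v}) ` V"
| "jigsaw V r E (Suc t) = jigsaw_step r E (jigsaw V r E t)"

definition percolates :: "nat set \<Rightarrow> nat \<Rightarrow> (nat \<Rightarrow> nat set set) \<Rightarrow> bool" where
  "percolates V r E \<longleftrightarrow> (\<exists>t. card (jigsaw V r E t) = 1)"

definition binomial_graph :: "nat \<Rightarrow> real \<Rightarrow> nat set set pmf" where
  "binomial_graph n q =
     map_pmf (\<lambda>f. {e \<in> vertex_pairs {1..n}. f e})
       (Pi_pmf (vertex_pairs {1..n}) False (\<lambda>_. bernoulli_pmf q))"

definition rfold_binomial_graph :: "nat \<Rightarrow> nat \<Rightarrow> (nat \<Rightarrow> real) \<Rightarrow> (nat \<Rightarrow> nat set set) pmf" where
  "rfold_binomial_graph n r q = Pi_pmf {1..r} {} (\<lambda>s. binomial_graph n (q s))"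

definition C_const :: "nat \<Rightarrow> real" where
  "C_const r = 2 ^ (8 * r\<^sup>2)"

end

theory Submission
  imports Defs "HOL-Real_Asymp.Real_Asymp"
begin

text \<open>Write \<open>l = ln n\<close>. If \<open>P\<^sub>i\<close> is small, percolation forces an internally spanned set of size between
  \<open>l\<close> and \<open>2 l + 2\<close> that carries a spanning tree's worth of edges in each of the first \<open>i\<close> colours,
  and a union bound excludes this; if \<open>p\<^sub>1\<close> is small, there is a vertex without neighbours of colour 1.

  If all \<open>P\<^sub>i\<close> are large, two facts suffice. First, no set of at least \<open>l\<^sup>2\<close> vertices is stuck,
  by a union bound over all sets, so that no fresh randomness is needed to finish from size \<open>l\<^sup>2\<close>.
  Secondly, a spanned set of size \<open>l\<^sup>2\<close> is found by repeated trials, each of which grows a cluster one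
  vertex at a time along a path of colour 1. A trial succeeds with probability at least
  \<open>n powr (- 1 / (16 r))\<close>, and \<open>n powr (1 / (8 r))\<close> almost independent trials are possible as long as
  \<open>p\<^sub>1 \<le> n powr (- 1 / (2 r))\<close>. For larger \<open>p\<^sub>1\<close> not even a single vertex is stuck.\<close>

section \<open>Product measures and independence\<close>

text \<open>The powers of \<open>ln n\<close> come from the size at which growth turns. As the
  \<open>p\<^sub>i\<close> increase, a cluster of size \<open>k\<close> gains about
  \<open>n * k^(i-1) * P\<^sub>i\<close> vertices through one of its vertices, for some
  \<open>i\<close>; for \<open>i >= 2\<close> and \<open>P\<^sub>i\<close> at the threshold this is
  of order \<open>(k / l)^(i-1)\<close>. So sizes near \<open>l\<close> are critical, and from size
  \<open>l\<^sup>2\<close> on the expected number of vertices joined to a set of size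
  \<open>k\<close> exceeds the \<open>k * l\<close> needed to beat the number of such sets.

  The obstacle is that failed tests leave negative information about unexplored vertices. A test is
  therefore made strong enough to imply all of it, at the price of a factor
  \<open>(1 - p\<^sub>1)^H\<close> for a history of length \<open>H\<close>. This factor stays above
  1/2 only while \<open>H * p\<^sub>1\<close> is small, whence the separate case of large
  \<open>p\<^sub>1\<close>.

  The constant \<open>2^(8 * r\<^sup>2)\<close> gives each of up to \<open>r - 1\<close> factors
  \<open>k / l\<close> an extra \<open>2^(8 * r)\<close>. The logarithmic cost of a trial drops to
  \<open>2 * r * l / 2^(4 * r)\<close>, which fits below \<open>l / (16 * r)\<close>.\<close>

definition determined_by :: "'i set \<Rightarrow> (('i \<Rightarrow> 'b) \<Rightarrow> bool) \<Rightarrow> bool" where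
  "determined_by B Q \<longleftrightarrow> (\<forall>f g. (\<forall>x\<in>B. f x = g x) \<longrightarrow> Q f = Q g)"

lemma determined_byD:
  "determined_by B Q \<Longrightarrow> (\<And>x. x \<in> B \<Longrightarrow> f x = g x) \<Longrightarrow> Q f = Q g"
  unfolding determined_by_def by blast

lemma determined_by_mono: "determined_by A Q \<Longrightarrow> A \<subseteq> B \<Longrightarrow> determined_by B Q"
  unfolding determined_by_def by blast

lemma determined_by_coordinate: "x \<in> B \<Longrightarrow> determined_by B (\<lambda>f. f x)"
  unfolding determined_by_def by blast

lemma determined_by_conj:
  "determined_by B P \<Longrightarrow> determined_by B Q \<Longrightarrow> determined_by B (\<lambda>f. P f \<and> Q f)"
  unfolding determined_by_def by metis

lemma determined_by_imp:
  "determined_by B P \<Longrightarrow> determined_by B Q \<Longrightarrow> determined_by B (\<lambda>f. P f \<longrightarrow> Q f)"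
  unfolding determined_by_def by metis

lemma determined_by_not: "determined_by B P \<Longrightarrow> determined_by B (\<lambda>f. \<not> P f)"
  unfolding determined_by_def by metis

lemma determined_by_ball:
  "(\<And>u. u \<in> U \<Longrightarrow> determined_by B (Q u)) \<Longrightarrow> determined_by B (\<lambda>f. \<forall>u\<in>U. Q u f)"
  unfolding determined_by_def by metis

lemma determined_by_bex:
  "(\<And>u. u \<in> U \<Longrightarrow> determined_by B (Q u)) \<Longrightarrow> determined_by B (\<lambda>f. \<exists>u\<in>U. Q u f)"
  unfolding determined_by_def by metis

lemma prob_pair_pmf_conj:
  "measure_pmf.prob (pair_pmf p q) {z. P (fst z) \<and> Q (snd z)}
     = measure_pmf.prob p {x. P x} * measure_pmf.prob q {y. Q y}"
proof -
  have "measure_pmf.prob (pair_pmf p q) {z. P (fst z) \<and> Q (snd z)}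
      = measure_pmf.prob (pair_pmf p q) (({x. P x} \<inter> set_pmf p) \<times> ({y. Q y} \<inter> set_pmf q))"
    by (intro measure_prob_cong_0) (auto simp: pmf_pair set_pmf_iff)
  also have "\<dots> = measure_pmf.prob p ({x. P x} \<inter> set_pmf p)
      * measure_pmf.prob q ({y. Q y} \<inter> set_pmf q)"
    by (intro measure_pmf_prob_product) auto
  finally show ?thesis by (simp add: measure_Int_set_pmf)
qed

lemma prob_map_pmf: "measure_pmf.prob (map_pmf f p) {y. P y} = measure_pmf.prob p {x. P (f x)}"
  by (simp add: vimage_def)

lemma prob_cong_set_pmf:
  "(\<And>x. x \<in> set_pmf p \<Longrightarrow> P x = Q x) \<Longrightarrow> measure_pmf.prob p {x. P x} = measure_pmf.prob p {x. Q x}"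
  by (intro measure_prob_cong_0) (auto simp: set_pmf_iff)

lemma prob_mono: "(\<And>x. P x \<Longrightarrow> Q x) \<Longrightarrow> measure_pmf.prob p {x. P x} \<le> measure_pmf.prob p {x. Q x}"
  by (intro measure_pmf.finite_measure_mono) auto

lemma prob_not: "measure_pmf.prob p {x. \<not> P x} = 1 - measure_pmf.prob p {x. P x}"
  using measure_pmf.prob_compl[of "{x. P x}" p] by (simp add: Compl_eq_Diff_UNIV[symmetric] Collect_neg_eq)

lemma prob_split:
  "measure_pmf.prob p {x. P x}
     = measure_pmf.prob p {x. P x \<and> Q x} + measure_pmf.prob p {x. P x \<and> \<not> Q x}"
proof -
  have "measure_pmf.prob p ({x. P x \<and> Q x} \<union> {x. P x \<and> \<not> Q x})
      = measure_pmf.prob p {x. P x \<and> Q x} + measure_pmf.prob p {x. P x \<and> \<not> Q x}"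
    by (intro measure_pmf.finite_measure_Union) auto
  moreover have "{x. P x \<and> Q x} \<union> {x. P x \<and> \<not> Q x} = {x. P x}" by auto
  ultimately show ?thesis by simp
qed

lemma prob_union_bound:
  assumes "finite I"
  shows "measure_pmf.prob p {x. \<exists>i\<in>I. P i x} \<le> (\<Sum>i\<in>I. measure_pmf.prob p {x. P i x})"
proof -
  have "{x. \<exists>i\<in>I. P i x} = (\<Union>i\<in>I. {x. P i x})" by auto
  then show ?thesis
    using measure_pmf.finite_measure_subadditive_finite[OF assms, of "\<lambda>i. {x. P i x}" p] by simp
qed

text \<open>The index set is cut along \<open>A\<close>. Coordinates of \<open>A\<close> outside
  \<open>I\<close> carry the default \<open>d\<close> in both halves, so \<open>P\<close> reads only
  the first half even if \<open>A\<close> is not inside \<open>I\<close>. This freedom allows sets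
  such as \<open>{s} \<times> UNIV\<close> later.\<close>

lemma prob_Pi_pmf_conj:
  assumes I: "finite I" and P: "determined_by A P" and Q: "determined_by B Q" and AB: "A \<inter> B = {}"
  shows "measure_pmf.prob (Pi_pmf I d p) {f. P f \<and> Q f}
     = measure_pmf.prob (Pi_pmf I d p) {f. P f} * measure_pmf.prob (Pi_pmf I d p) {f. Q f}"
proof -
  define p1 where "p1 = Pi_pmf (I \<inter> A) d p"
  define p2 where "p2 = Pi_pmf (I - A) d p"
  have "Pi_pmf ((I \<inter> A) \<union> (I - A)) d p
      = map_pmf (\<lambda>(f,g) x. if x \<in> I \<inter> A then f x else g x) (pair_pmf p1 p2)"
    unfolding p1_def p2_def using I by (intro Pi_pmf_union) auto
  then have eq: "Pi_pmf I d p = map_pmf (\<lambda>z x. if x \<in> I \<inter> A then fst z x else snd z x) (pair_pmf p1 p2)"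
    by (simp add: Un_Diff_Int Int_Un_distrib case_prod_unfold Un_commute)
  have s1: "f x = d" if "f \<in> set_pmf p1" "x \<notin> I \<inter> A" for f x
    using that set_Pi_pmf_subset[of "I \<inter> A" d p] I unfolding p1_def by auto
  have s2: "f x = d" if "f \<in> set_pmf p2" "x \<notin> I - A" for f x
    using that set_Pi_pmf_subset[of "I - A" d p] I unfolding p2_def by auto
  let ?m = "\<lambda>z x. if x \<in> I \<inter> A then fst z x else snd z x"
  have mP: "P (?m z) = P (fst z)" if "z \<in> set_pmf (pair_pmf p1 p2)" for z
  proof (rule determined_byD[OF P])
    fix x assume "x \<in> A"
    then show "?m z x = fst z x" using that s1[of "fst z" x] s2[of "snd z" x] by auto
  qed
  have mQ: "Q (?m z) = Q (snd z)" if "z \<in> set_pmf (pair_pmf p1 p2)" for z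
  proof (rule determined_byD[OF Q])
    fix x assume "x \<in> B"
    then show "?m z x = snd z x" using AB by auto
  qed
  have *: "measure_pmf.prob (Pi_pmf I d p) {f. R f \<and> S f}
      = measure_pmf.prob p1 {f. R f} * measure_pmf.prob p2 {f. S f}"
    if "\<And>z. z \<in> set_pmf (pair_pmf p1 p2) \<Longrightarrow> R (?m z) = R (fst z)"
       "\<And>z. z \<in> set_pmf (pair_pmf p1 p2) \<Longrightarrow> S (?m z) = S (snd z)" for R S
  proof -
    have "measure_pmf.prob (Pi_pmf I d p) {f. R f \<and> S f}
        = measure_pmf.prob (pair_pmf p1 p2) {z. R (?m z) \<and> S (?m z)}"
      unfolding eq by (rule prob_map_pmf)
    also have "\<dots> = measure_pmf.prob (pair_pmf p1 p2) {z. R (fst z) \<and> S (snd z)}"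
      using that by (intro prob_cong_set_pmf) auto
    finally show ?thesis by (simp only: prob_pair_pmf_conj)
  qed
  have "measure_pmf.prob (Pi_pmf I d p) {f. P f} = measure_pmf.prob p1 {f. P f}"
    using *[of P "\<lambda>_. True"] mP by simp
  moreover have "measure_pmf.prob (Pi_pmf I d p) {f. Q f} = measure_pmf.prob p2 {f. Q f}"
    using *[of "\<lambda>_. True" Q] mQ by simp
  ultimately show ?thesis using *[of P Q] mP mQ by simp
qed

lemma prob_Pi_pmf_ball:
  assumes I: "finite I" and U: "finite U" and Q: "\<And>u. u \<in> U \<Longrightarrow> determined_by (B u) (Q u)"
    and disj: "\<And>u v. u \<in> U \<Longrightarrow> v \<in> U \<Longrightarrow> u \<noteq> v \<Longrightarrow> B u \<inter> B v = {}"
  shows "measure_pmf.prob (Pi_pmf I d p) {f. \<forall>u\<in>U. Q u f}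
     = (\<Prod>u\<in>U. measure_pmf.prob (Pi_pmf I d p) {f. Q u f})"
  using U Q disj
proof (induction U rule: finite_induct)
  case empty
  then show ?case by simp
next
  case (insert x F)
  have "measure_pmf.prob (Pi_pmf I d p) {f. \<forall>u\<in>insert x F. Q u f}
      = measure_pmf.prob (Pi_pmf I d p) {f. Q x f \<and> (\<forall>u\<in>F. Q u f)}"
    by simp
  also have "\<dots> = measure_pmf.prob (Pi_pmf I d p) {f. Q x f}
      * measure_pmf.prob (Pi_pmf I d p) {f. \<forall>u\<in>F. Q u f}"
  proof (rule prob_Pi_pmf_conj[OF I, of "B x" _ "\<Union>u\<in>F. B u"])
    show "determined_by (B x) (Q x)" using insert.prems by auto
    show "determined_by (\<Union>u\<in>F. B u) (\<lambda>f. \<forall>u\<in>F. Q u f)"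
      using insert.prems by (intro determined_by_ball) (meson UN_upper determined_by_mono insertI2)
    show "B x \<inter> (\<Union>u\<in>F. B u) = {}" using insert.prems(2)[of x] insert.hyps by auto
  qed
  finally show ?case using insert by simp
qed

section \<open>The random r-fold graph as one family of independent indicators\<close>

definition coloured_pairs :: "nat \<Rightarrow> nat \<Rightarrow> (nat \<times> nat set) set" where
  "coloured_pairs n r = {1..r} \<times> vertex_pairs {1..n}"

text \<open>A single flat product instead of a product of products: independence across colours,
  vertices and stages of an exploration all becomes disjointness of sets of coloured pairs.\<close>

definition indicator_pmf :: "nat \<Rightarrow> nat \<Rightarrow> (nat \<Rightarrow> real) \<Rightarrow> (nat \<times> nat set \<Rightarrow> bool) pmf" where
  "indicator_pmf n r q = Pi_pmf (coloured_pairs n r) False (\<lambda>x. bernoulli_pmf (q (fst x)))"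

definition edges_of :: "(nat \<times> nat set \<Rightarrow> bool) \<Rightarrow> nat \<Rightarrow> nat set set" where
  "edges_of w s = {e. w (s, e)}"

lemma finite_vertex_pairs: "finite V \<Longrightarrow> finite (vertex_pairs V)"
  unfolding vertex_pairs_def by (rule finite_subset[of _ "Pow V"]) auto

lemma finite_coloured_pairs: "finite (coloured_pairs n r)"
  unfolding coloured_pairs_def by (simp add: finite_vertex_pairs)

lemma rfold_binomial_graph_eq: "rfold_binomial_graph n r q = map_pmf edges_of (indicator_pmf n r q)"
proof -
  let ?V = "vertex_pairs {1..n}"
  let ?h = "\<lambda>f. {e \<in> ?V. f e}"
  let ?B = "\<lambda>s. Pi_pmf ?V False (\<lambda>_. bernoulli_pmf (q s))"
  have finV: "finite ?V" by (simp add: finite_vertex_pairs)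
  \<comment> \<open>Point masses are compared; \<open>curry\<close> is injective and thus preserves
    them. Off the support both sides vanish, the nested product for one of two reasons: a wrong
    colour or a wrong pair.\<close>
  have nested: "Pi_pmf {1..r} (\<lambda>_. False) ?B = map_pmf curry (indicator_pmf n r q)"
  proof (rule pmf_eqI)
    fix F :: "nat \<Rightarrow> nat set \<Rightarrow> bool"
    let ?f = "case_prod F"
    have "pmf (map_pmf curry (indicator_pmf n r q)) F = pmf (map_pmf curry (indicator_pmf n r q)) (curry ?f)"
      by simp
    also have "\<dots> = pmf (indicator_pmf n r q) ?f"
      by (rule pmf_map_inj') (auto simp: inj_def curry_def fun_eq_iff)
    also have "\<dots> = pmf (Pi_pmf {1..r} (\<lambda>_. False) ?B) F"
    proof (cases "\<forall>x. x \<notin> coloured_pairs n r \<longrightarrow> ?f x = False")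
      case True
      then have "pmf (indicator_pmf n r q) ?f
          = (\<Prod>x\<in>coloured_pairs n r. pmf (bernoulli_pmf (q (fst x))) (?f x))"
        unfolding indicator_pmf_def by (subst pmf_Pi') (auto simp: finite_coloured_pairs)
      also have "\<dots> = (\<Prod>s\<in>{1..r}. \<Prod>e\<in>?V. pmf (bernoulli_pmf (q s)) (F s e))"
        unfolding coloured_pairs_def by (subst prod.cartesian_product) (auto intro!: prod.cong)
      also have "\<dots> = (\<Prod>s\<in>{1..r}. pmf (?B s) (F s))"
      proof (rule prod.cong[OF refl])
        fix s assume "s \<in> {1..r}"
        show "(\<Prod>e\<in>?V. pmf (bernoulli_pmf (q s)) (F s e)) = pmf (?B s) (F s)"
          using True finV by (subst pmf_Pi') (auto simp: coloured_pairs_def)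
      qed
      also have "\<dots> = pmf (Pi_pmf {1..r} (\<lambda>_. False) ?B) F"
        using True by (subst pmf_Pi') (auto simp: coloured_pairs_def fun_eq_iff)
      finally show ?thesis .
    next
      case False
      then obtain s e where se: "(s, e) \<notin> coloured_pairs n r" "F s e" by auto
      have "pmf (indicator_pmf n r q) ?f = 0"
        unfolding indicator_pmf_def using False by (intro pmf_Pi_outside finite_coloured_pairs) auto
      moreover have "pmf (Pi_pmf {1..r} (\<lambda>_. False) ?B) F = 0"
      proof (cases "s \<in> {1..r}")
        case True
        then have "e \<notin> ?V" using se by (auto simp: coloured_pairs_def)
        then have "pmf (?B s) (F s) = 0" using se finV by (intro pmf_Pi_outside) auto
        then show ?thesis using True by (subst pmf_Pi) (auto intro!: prod_zero)
      next
        case False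
        then show ?thesis using se by (intro pmf_Pi_outside) (auto simp: fun_eq_iff)
      qed
      ultimately show ?thesis by simp
    qed
    finally show "pmf (Pi_pmf {1..r} (\<lambda>_. False) ?B) F = pmf (map_pmf curry (indicator_pmf n r q)) F"
      by simp
  qed
  have "rfold_binomial_graph n r q = Pi_pmf {1..r} (?h (\<lambda>_. False)) (\<lambda>s. map_pmf ?h (?B s))"
    unfolding rfold_binomial_graph_def binomial_graph_def by simp
  also have "\<dots> = map_pmf (\<lambda>F. ?h \<circ> F) (Pi_pmf {1..r} (\<lambda>_. False) ?B)"
    by (rule Pi_pmf_map) auto
  also have "\<dots> = map_pmf (\<lambda>w. ?h \<circ> curry w) (indicator_pmf n r q)"
    unfolding nested by (simp add: pmf.map_comp o_def)
  \<comment> \<open>Filtering to \<open>?V\<close> changes nothing on the support, where every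
    indicator outside \<open>coloured_pairs n r\<close> is \<open>False\<close>.\<close>
  also have "\<dots> = map_pmf edges_of (indicator_pmf n r q)"
  proof (rule map_pmf_cong[OF refl])
    fix w assume "w \<in> set_pmf (indicator_pmf n r q)"
    then have "w x = False" if "x \<notin> coloured_pairs n r" for x
      using that set_Pi_pmf_subset[OF finite_coloured_pairs, of n r False] unfolding indicator_pmf_def by blast
    then show "?h \<circ> curry w = edges_of w"
      by (fastforce simp: edges_of_def coloured_pairs_def fun_eq_iff)
  qed
  finally show ?thesis .
qed

lemma prob_rfold:
  "measure_pmf.prob (rfold_binomial_graph n r q) {E. Q E}
     = measure_pmf.prob (indicator_pmf n r q) {w. Q (edges_of w)}"
  unfolding rfold_binomial_graph_eq by (rule prob_map_pmf)

lemmas prob_indicator_conj = prob_Pi_pmf_conj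
  [OF finite_coloured_pairs, where d = False and p = "\<lambda>x. bernoulli_pmf (q (fst x))",
   folded indicator_pmf_def] for q
lemmas prob_indicator_ball = prob_Pi_pmf_ball
  [OF finite_coloured_pairs, where d = False and p = "\<lambda>x. bernoulli_pmf (q (fst x))",
   folded indicator_pmf_def] for q

lemma prob_indicator_coordinate:
  assumes "x \<in> coloured_pairs n r" "0 \<le> q (fst x)" "q (fst x) \<le> 1"
  shows "measure_pmf.prob (indicator_pmf n r q) {w. w x} = q (fst x)"
proof -
  have "measure_pmf.prob (indicator_pmf n r q) {w. w x}
      = measure_pmf.prob (map_pmf (\<lambda>w. w x) (indicator_pmf n r q)) {b. b}"
    by (rule prob_map_pmf[symmetric])
  also have "map_pmf (\<lambda>w. w x) (indicator_pmf n r q) = bernoulli_pmf (q (fst x))"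
    unfolding indicator_pmf_def using assms by (subst Pi_pmf_component) (auto simp: finite_coloured_pairs)
  also have "{b. b} = {True}" by auto
  finally show ?thesis using assms by (simp add: measure_pmf_single)
qed

lemma prob_indicator_all:
  assumes "finite A" "A \<subseteq> coloured_pairs n r" "\<And>x. x \<in> A \<Longrightarrow> fst x = s" "0 \<le> q s" "q s \<le> 1"
  shows "measure_pmf.prob (indicator_pmf n r q) {w. \<forall>x\<in>A. w x} = q s ^ card A"
proof -
  have "measure_pmf.prob (indicator_pmf n r q) {w. \<forall>x\<in>A. w x}
      = (\<Prod>x\<in>A. measure_pmf.prob (indicator_pmf n r q) {w. w x})"
    using assms(1) by (intro prob_indicator_ball[where B="\<lambda>x. {x}" and Q="\<lambda>x w. w x"])
      (simp_all add: determined_by_coordinate)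
  also have "\<dots> = (\<Prod>x\<in>A. q s)"
    using assms by (intro prod.cong refl) (subst prob_indicator_coordinate, auto)
  finally show ?thesis by simp
qed

lemma prob_indicator_none:
  assumes "finite A" "A \<subseteq> coloured_pairs n r" "\<And>x. x \<in> A \<Longrightarrow> fst x = s" "0 \<le> q s" "q s \<le> 1"
  shows "measure_pmf.prob (indicator_pmf n r q) {w. \<forall>x\<in>A. \<not> w x} = (1 - q s) ^ card A"
proof -
  have "measure_pmf.prob (indicator_pmf n r q) {w. \<forall>x\<in>A. \<not> w x}
      = (\<Prod>x\<in>A. measure_pmf.prob (indicator_pmf n r q) {w. \<not> w x})"
    using assms(1)
    by (intro prob_indicator_ball[where B="\<lambda>x. {x}" and Q="\<lambda>x w. \<not> w x"])
      (simp_all add: determined_by_coordinate determined_by_not)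
  also have "\<dots> = (\<Prod>x\<in>A. 1 - q s)"
    using assms by (intro prod.cong refl) (subst prob_not, subst prob_indicator_coordinate, auto)
  finally show ?thesis by simp
qed

section \<open>Spanned sets\<close>

definition linked :: "nat \<Rightarrow> (nat \<Rightarrow> nat set set) \<Rightarrow> nat set \<Rightarrow> nat set \<Rightarrow> bool" where
  "linked r E A B \<longleftrightarrow> (\<forall>s\<in>{1..r}. \<exists>u\<in>A. \<exists>v\<in>B. {u, v} \<in> E s)"

text \<open>The internally spanned sets of bootstrap percolation. Merges are binary and
  asynchronous, unlike the rounds of \<open>jigsaw\<close>, so that edge counts and sizes can be
  followed through one merge at a time.\<close>

inductive spanned :: "nat \<Rightarrow> (nat \<Rightarrow> nat set set) \<Rightarrow> nat set \<Rightarrow> bool" for r E where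
  single: "spanned r E {v}"
| merge: "spanned r E A \<Longrightarrow> spanned r E B \<Longrightarrow> A \<inter> B = {} \<Longrightarrow> linked r E A B \<Longrightarrow> spanned r E (A \<union> B)"

lemma linked_sym: "linked r E A B \<Longrightarrow> linked r E B A"
  unfolding linked_def by (metis insert_commute)

lemma linked_mono: "linked r E A B \<Longrightarrow> A \<subseteq> A' \<Longrightarrow> B \<subseteq> B' \<Longrightarrow> linked r E A' B'"
  unfolding linked_def by (meson subsetD)

lemma clusters_joined_linked: "clusters_joined r E C D \<longleftrightarrow> C \<noteq> D \<and> linked r E C D"
  unfolding clusters_joined_def linked_def by simp

lemma spanned_finite: "spanned r E A \<Longrightarrow> finite A \<and> A \<noteq> {}"
  by (induction rule: spanned.induct) auto

lemma spanned_insert: "spanned r E A \<Longrightarrow> v \<notin> A \<Longrightarrow> linked r E {v} A \<Longrightarrow> spanned r E (insert v A)"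
  using spanned.merge[OF spanned.single[of r E v], of A] by simp

text \<open>Each merge supplies a crossing pair of colour \<open>s\<close> that lies inside neither
  part, so edges accumulate as in a spanning tree. The number of edges is all that the union bound
  uses; connectivity is not recorded.\<close>

lemma spanned_card_edges:
  assumes "spanned r E A" "s \<in> {1..r}"
  shows "card A \<le> card {e \<in> E s. e \<in> vertex_pairs A} + 1"
  using assms(1)
proof (induction rule: spanned.induct)
  case (single v)
  then show ?case by simp
next
  case (merge A B)
  let ?F = "\<lambda>A. {e \<in> E s. e \<in> vertex_pairs A}"
  have fin: "finite A" "finite B" using merge.hyps spanned_finite by auto
  have finF: "finite (?F X)" if "finite X" for X
    using finite_vertex_pairs[OF that] by (rule rev_finite_subset) auto
  obtain u v where uv: "u \<in> A" "v \<in> B" "{u, v} \<in> E s"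
    using merge.hyps(4) assms(2) unfolding linked_def by blast
  have "u \<noteq> v" using uv merge.hyps by auto
  then have e: "{u, v} \<in> ?F (A \<union> B)" using uv by (auto simp: vertex_pairs_def)
  have e': "{u, v} \<notin> ?F A \<union> ?F B" using uv merge.hyps by (auto simp: vertex_pairs_def)
  have disj: "?F A \<inter> ?F B = {}"
  proof -
    have False if "e \<subseteq> A" "e \<subseteq> B" "card e = 2" for e
    proof -
      have "e = {}" using that(1,2) merge.hyps(3) by auto
      then show False using that(3) by simp
    qed
    then show ?thesis by (auto simp: vertex_pairs_def)
  qed
  have "insert {u, v} (?F A \<union> ?F B) \<subseteq> ?F (A \<union> B)" using e by (auto simp: vertex_pairs_def)
  then have "card (insert {u, v} (?F A \<union> ?F B)) \<le> card (?F (A \<union> B))"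
    using fin finF by (intro card_mono) auto
  moreover have "card (insert {u, v} (?F A \<union> ?F B)) = card (?F A) + card (?F B) + 1"
    using e' disj fin finF by (simp add: card_Un_disjoint)
  moreover have "card (A \<union> B) = card A + card B"
    using fin merge.hyps by (simp add: card_Un_disjoint)
  ultimately show ?case using merge.IH by simp
qed

text \<open>At a merge, the part containing \<open>x\<close> either has another vertex already, or
  is \<open>{x}\<close>, and then the linking edge of colour \<open>s\<close> must end at
  \<open>x\<close>.\<close>

lemma spanned_no_isolated:
  assumes "spanned r E A" "s \<in> {1..r}"
  shows "card A \<ge> 2 \<Longrightarrow> x \<in> A \<Longrightarrow> \<exists>y\<in>A. y \<noteq> x \<and> {x, y} \<in> E s"
  using assms(1)
proof (induction rule: spanned.induct)
  case (single v)
  then show ?case by simp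
next
  case (merge A B)
  have aux: "\<exists>y\<in>X \<union> Y. y \<noteq> x \<and> {x, y} \<in> E s"
    if X: "spanned r E X" "x \<in> X" "card X \<ge> 2 \<Longrightarrow> x \<in> X \<Longrightarrow> \<exists>y\<in>X. y \<noteq> x \<and> {x, y} \<in> E s"
      and Y: "X \<inter> Y = {}" "linked r E X Y" for X Y
  proof (cases "card X \<ge> 2")
    case True
    then show ?thesis using X by auto
  next
    case False
    then have "X = {x}" using X spanned_finite[OF X(1)]
      by (metis One_nat_def Suc_1 card_1_singletonE card_gt_0_iff le_antisym not_less_eq_eq singletonD Suc_leI)
    then show ?thesis using Y assms(2) unfolding linked_def by fastforce
  qed
  show ?case
  proof (cases "x \<in> A")
    case True
    from aux[OF merge.hyps(1) this merge.IH(1) merge.hyps(3,4)] show ?thesis by simp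
  next
    case False
    then have "x \<in> B" using merge.prems by simp
    from aux[OF merge.hyps(2) this merge.IH(2) _ linked_sym[OF merge.hyps(4)]] merge.hyps(3)
    show ?thesis by (simp add: Int_commute Un_commute)
  qed
qed

text \<open>The Aizenman-Lebowitz argument: at a merge where both parts are smaller than
  \<open>L\<close> but the union is not, the union has fewer than \<open>2 * L\<close>
  elements.\<close>

lemma spanned_intermediate:
  assumes "spanned r E A" "1 \<le> L" "L \<le> card A"
  shows "\<exists>B\<subseteq>A. spanned r E B \<and> L \<le> card B \<and> card B \<le> 2 * L"
  using assms(1,3)
proof (induction rule: spanned.induct)
  case (single v)
  then show ?case using assms(2) by (intro exI[of _ "{v}"]) (auto intro: spanned.single)
next
  case (merge A B)
  consider "L \<le> card A" | "L \<le> card B" | "card A < L" "card B < L" by linarith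
  then show ?case
  proof cases
    case 1
    then show ?thesis using merge.IH(1) by (meson le_supI1)
  next
    case 2
    then show ?thesis using merge.IH(2) by (meson le_supI2)
  next
    case 3
    then have "card (A \<union> B) \<le> 2 * L" using card_Un_le[of A B] by linarith
    then show ?thesis using merge by (intro exI[of _ "A \<union> B"]) (auto intro: spanned.merge)
  qed
qed

text \<open>A component of the cluster graph is absorbed cluster by cluster, so that one step of the
  algorithm decomposes into binary merges.\<close>

lemma spanned_component:
  assumes fin: "finite P" and sp: "\<And>C. C \<in> P \<Longrightarrow> spanned r E C" and disj: "disjoint P"
    and C: "C \<in> P"
  shows "spanned r E (\<Union>((cluster_graph r E P)\<^sup>* `` {C}))"
proof -
  let ?R = "cluster_graph r E P"
  let ?K = "?R\<^sup>* `` {C}"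
  have RP: "?R \<subseteq> P \<times> P" by (auto simp: cluster_graph_def)
  have KP: "?K \<subseteq> P"
  proof
    fix D assume "D \<in> ?K"
    then have "(C, D) \<in> ?R\<^sup>*" by simp
    then show "D \<in> P" by (induction rule: rtrancl_induct) (use C RP in auto)
  qed
  define \<F> where "\<F> = {K'. K' \<subseteq> ?K \<and> C \<in> K' \<and> spanned r E (\<Union>K')}"
  have "{C} \<in> \<F>" unfolding \<F>_def using sp[OF C] by auto
  moreover have "finite \<F>"
    unfolding \<F>_def by (rule finite_subset[of _ "Pow P"]) (use KP fin in auto)
  \<comment> \<open>Maximality replaces an enumeration of the component: a cluster adjacent to a
    member of \<open>M\<close> but missing from \<open>M\<close> could still be absorbed.\<close>
  ultimately obtain M where M: "M \<in> \<F>" "\<And>M'. M' \<in> \<F> \<Longrightarrow> M \<subseteq> M' \<Longrightarrow> M' = M"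
    using finite_has_maximal[of \<F>] by blast
  have "D \<in> M" if "(C, D) \<in> ?R\<^sup>*" for D
    using that
  proof (induction rule: rtrancl_induct)
    case base
    then show ?case using M(1) by (auto simp: \<F>_def)
  next
    case (step y z)
    show ?case
    proof (rule ccontr)
      assume z: "z \<notin> M"
      have yz: "y \<in> P" "z \<in> P" "linked r E y z"
        using step.hyps(2) by (auto simp: cluster_graph_def clusters_joined_linked)
      have MP: "M \<subseteq> P" using M(1) KP by (auto simp: \<F>_def)
      have "X \<inter> z = {}" if "X \<in> M" for X
        using MP z yz(2) disj that unfolding disjoint_def by (metis subsetD)
      then have "\<Union>M \<inter> z = {}" by blast
      then have "spanned r E (\<Union>M \<union> z)"
        using M(1) sp[OF yz(2)] linked_mono[OF yz(3), of "\<Union>M" z] step.IH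
        by (intro spanned.merge) (auto simp: \<F>_def)
      then have "insert z M \<in> \<F>"
        using M(1) step.hyps by (auto simp: \<F>_def Un_commute intro: rtrancl_into_rtrancl)
      then show False using M(2)[of "insert z M"] z by auto
    qed
  qed
  then have "M = ?K" using M(1) by (auto simp: \<F>_def)
  then show ?thesis using M(1) by (simp add: \<F>_def)
qed

section \<open>Invariant and termination of the jigsaw algorithm\<close>

definition spanned_partition :: "nat set \<Rightarrow> nat \<Rightarrow> (nat \<Rightarrow> nat set set) \<Rightarrow> nat set set \<Rightarrow> bool" where
  "spanned_partition V r E P \<longleftrightarrow>
     finite P \<and> \<Union>P = V \<and> disjoint P \<and> (\<forall>C\<in>P. spanned r E C)"

text \<open>The reflexive closure relates every set to itself, also outside \<open>P\<close>; only
  after restriction to \<open>P \<times> P\<close> is it an equivalence on \<open>P\<close>. The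
  restriction leaves the classes of members of \<open>P\<close> unchanged.\<close>

lemma equiv_components: "equiv P ((cluster_graph r E P)\<^sup>* \<inter> P \<times> P)"
proof (rule equivI)
  have "sym ((cluster_graph r E P)\<^sup>*)"
    by (intro sym_rtrancl) (auto simp: sym_def cluster_graph_def clusters_joined_linked intro: linked_sym)
  then show "sym ((cluster_graph r E P)\<^sup>* \<inter> P \<times> P)" unfolding sym_def by blast
  show "refl_on P ((cluster_graph r E P)\<^sup>* \<inter> P \<times> P)" unfolding refl_on_def by blast
  show "trans ((cluster_graph r E P)\<^sup>* \<inter> P \<times> P)"
    by (rule transI) (blast intro: rtrancl_trans)
qed blast

lemma quotient_components:
  "P // (cluster_graph r E P)\<^sup>* = P // ((cluster_graph r E P)\<^sup>* \<inter> P \<times> P)"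
proof -
  have "(cluster_graph r E P)\<^sup>* `` {C} = ((cluster_graph r E P)\<^sup>* \<inter> P \<times> P) `` {C}" if "C \<in> P" for C
  proof -
    have "D \<in> P" if "(C, D) \<in> (cluster_graph r E P)\<^sup>*" for D
      using that by (induction rule: rtrancl_induct) (use \<open>C \<in> P\<close> in \<open>auto simp: cluster_graph_def\<close>)
    then show ?thesis using that by auto
  qed
  then show ?thesis unfolding quotient_def by auto
qed

lemma spanned_partition_step:
  assumes "spanned_partition V r E P"
  shows "spanned_partition V r E (jigsaw_step r E P)"
proof (cases "cluster_graph r E P = {}")
  case True
  then show ?thesis using assms by (simp add: jigsaw_step_def)
next
  case False
  let ?R = "(cluster_graph r E P)\<^sup>*"
  let ?R' = "?R \<inter> P \<times> P"
  have P: "finite P" "\<Union>P = V" "disjoint P" "\<And>C. C \<in> P \<Longrightarrow> spanned r E C"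
    using assms by (auto simp: spanned_partition_def)
  have eq: "jigsaw_step r E P = \<Union> ` (P // ?R')"
    unfolding jigsaw_step_def quotient_components[symmetric] using False by (rule if_not_P)
  have U: "\<Union>(P // ?R') = P" using equiv_components by (rule Union_quotient)
  have fin: "finite (P // ?R')" using P(1) by (intro finite_quotient) auto
  have "\<Union>(\<Union> ` \<A>) = \<Union>(\<Union>\<A>)" for \<A> :: "nat set set set" by auto
  then have 1: "\<Union>(jigsaw_step r E P) = V" using U P(2) by (simp only: eq)
  have 2: "disjoint (jigsaw_step r E P)"
    unfolding disjoint_def
  proof (intro ballI impI)
    fix a b assume "a \<in> jigsaw_step r E P" "b \<in> jigsaw_step r E P" "a \<noteq> b"
    then obtain X Y where XY: "X \<in> P // ?R'" "Y \<in> P // ?R'" "a = \<Union>X" "b = \<Union>Y" "X \<noteq> Y"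
      unfolding eq by (elim imageE) metis
    have "X \<inter> Y = {}" using quotient_disj[OF equiv_components XY(1,2)] XY(5) by blast
    moreover have "X \<subseteq> P" "Y \<subseteq> P" using XY(1,2) U by auto
    ultimately have "c \<inter> d = {}" if "c \<in> X" "d \<in> Y" for c d
      using that by (intro disjointD[OF P(3)]) auto
    then show "a \<inter> b = {}" unfolding XY(3,4) by blast
  qed
  have 3: "spanned r E D" if "D \<in> jigsaw_step r E P" for D
  proof -
    have "D \<in> \<Union> ` (P // ?R)" using that unfolding eq quotient_components .
    then obtain X where X: "X \<in> P // ?R" "D = \<Union>X" by (elim imageE)
    obtain C where "C \<in> P" "X = ?R `` {C}" using X(1) by (rule quotientE)
    then have C: "C \<in> P" "D = \<Union>(?R `` {C})" using X(2) by simp_all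
    show ?thesis unfolding C(2) by (rule spanned_component[OF P(1,4,3) C(1)])
  qed
  have "finite (jigsaw_step r E P)" unfolding eq using fin by (rule finite_imageI)
  then show ?thesis unfolding spanned_partition_def using 1 2 3 by blast
qed

lemma card_jigsaw_step_less:
  assumes "finite P" "cluster_graph r E P \<noteq> {}"
  shows "card (jigsaw_step r E P) < card P"
proof -
  let ?R' = "(cluster_graph r E P)\<^sup>* \<inter> P \<times> P"
  obtain C D where CD: "(C, D) \<in> cluster_graph r E P" using assms(2) by auto
  then have CD': "C \<in> P" "D \<in> P" "C \<noteq> D" "(C, D) \<in> ?R'"
    by (auto simp: cluster_graph_def clusters_joined_linked)
  have "P // ?R' = (\<lambda>X. ?R' `` {X}) ` P" by (auto simp: quotient_def)
  also have "\<dots> = (\<lambda>X. ?R' `` {X}) ` (P - {D})"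
    using CD' equiv_class_eq[OF equiv_components CD'(4)] by (auto simp: image_iff)
  finally have "card (P // ?R') \<le> card (P - {D})" using assms(1) by (simp add: card_image_le)
  also have "\<dots> < card P" using CD'(2) assms(1) by (intro psubset_card_mono) auto
  finally have "card (P // ?R') < card P" .
  moreover have "card (jigsaw_step r E P) \<le> card (P // ?R')"
    using assms by (simp add: jigsaw_step_def quotient_components card_image_le finite_quotient)
  ultimately show ?thesis by linarith
qed

lemma spanned_partition_jigsaw: "finite V \<Longrightarrow> spanned_partition V r E (jigsaw V r E t)"
proof (induction t)
  case 0
  then show ?case by (auto simp: spanned_partition_def disjoint_def intro: spanned.single)
next
  case (Suc t)
  then show ?case by (simp add: spanned_partition_step)
qed

lemma percolates_imp_spanned:
  assumes "finite V" "percolates V r E"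
  shows "spanned r E V"
proof -
  obtain t where "card (jigsaw V r E t) = 1" using assms(2) by (auto simp: percolates_def)
  then obtain C where "jigsaw V r E t = {C}" by (auto simp: card_1_singleton_iff)
  then show ?thesis using spanned_partition_jigsaw[OF assms(1), of r E t] by (auto simp: spanned_partition_def)
qed

lemma jigsaw_stops:
  assumes "finite V"
  shows "\<exists>t. cluster_graph r E (jigsaw V r E t) = {}"
proof (rule ccontr)
  assume *: "\<nexists>t. cluster_graph r E (jigsaw V r E t) = {}"
  have "card (jigsaw V r E t) + t \<le> card (jigsaw V r E 0)" for t
  proof (induction t)
    case (Suc t)
    have "card (jigsaw V r E (Suc t)) < card (jigsaw V r E t)"
      unfolding jigsaw.simps(2)
    proof (rule card_jigsaw_step_less)
      show "finite (jigsaw V r E t)"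
        using spanned_partition_jigsaw[OF assms] by (simp add: spanned_partition_def)
    qed (use * in blast)
    then show ?case using Suc by linarith
  qed simp
  from this[of "Suc (card (jigsaw V r E 0))"] show False by linarith
qed

text \<open>Only single outside vertices are tested, not outside clusters. For a fixed
  \<open>S\<close> the tests of different vertices then involve disjoint sets of pairs and are
  independent.\<close>

definition stuck :: "nat set \<Rightarrow> nat \<Rightarrow> (nat \<Rightarrow> nat set set) \<Rightarrow> nat set \<Rightarrow> bool" where
  "stuck V r E S \<longleftrightarrow> S \<subseteq> V \<and> S \<noteq> V \<and> (\<forall>u\<in>V - S. \<not> linked r E {u} S)"

text \<open>In the final partition linked clusters coincide, so by induction every spanned subset of
  \<open>V\<close> lies in one cluster. If the cluster around \<open>S\<close> were not
  \<open>V\<close>, an outside vertex linked to it would make its own cluster linked as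
  well.\<close>

lemma percolates_if_not_stuck:
  assumes V: "finite V" and S: "spanned r E S" "S \<subseteq> V"
    and ns: "\<And>C. S \<subseteq> C \<Longrightarrow> \<not> stuck V r E C"
  shows "percolates V r E"
proof -
  obtain t where t: "cluster_graph r E (jigsaw V r E t) = {}" using jigsaw_stops[OF V] by blast
  let ?P = "jigsaw V r E t"
  have P: "\<Union>?P = V" "disjoint ?P" "spanned_partition V r E ?P"
    using spanned_partition_jigsaw[OF V, of r E t] unfolding spanned_partition_def by simp_all
  have nolink: "C = D" if "C \<in> ?P" "D \<in> ?P" "linked r E C D" for C D
    using t that by (auto simp: cluster_graph_def clusters_joined_linked)
  have "\<exists>C\<in>?P. A \<subseteq> C" if "spanned r E A" "A \<subseteq> V" for A
    using that
  proof (induction rule: spanned.induct)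
    case (single v)
    then have "v \<in> \<Union>?P" unfolding P(1) by simp
    then show ?case by (elim UnionE) (auto simp del: jigsaw.simps)
  next
    case (merge A B)
    then obtain C D where CD: "C \<in> ?P" "A \<subseteq> C" "D \<in> ?P" "B \<subseteq> D" by (meson Un_subset_iff)
    have "C = D" using CD(1,3) linked_mono[OF merge.hyps(4) CD(2,4)] by (rule nolink)
    then show ?case using CD by (intro bexI[of _ C]) auto
  qed
  then obtain C where C: "C \<in> ?P" "S \<subseteq> C" using S by meson
  have CV: "C \<subseteq> V" using C(1) P(1) by (metis Union_upper)
  have "C = V"
  proof (rule ccontr)
    assume "C \<noteq> V"
    then obtain u where u: "u \<in> V - C" "linked r E {u} C"
      using ns[OF C(2)] CV by (auto simp: stuck_def)
    then have "u \<in> \<Union>?P" unfolding P(1) by simp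
    then obtain D where D: "D \<in> ?P" "u \<in> D" by (rule UnionE)
    have "linked r E D C" using linked_mono[OF u(2), of D C] D(2) by simp
    with D(1) C(1) have "D = C" by (rule nolink)
    then show False using D u by simp
  qed
  have "?P = {C}"
  proof -
    have "D = C" if "D \<in> ?P" for D
    proof (rule ccontr)
      assume "D \<noteq> C"
      then have "D \<inter> C = {}" by (intro disjointD[OF P(2) that C(1)])
      moreover have "D \<subseteq> C" using P(1) that unfolding \<open>C = V\<close> by (metis Union_upper)
      moreover have "D \<noteq> {}" using that P(3) spanned_finite unfolding spanned_partition_def by metis
      ultimately show False by (metis Int_absorb2)
    qed
    then show ?thesis using C(1) by (intro equalityI subsetI) blast+
  qed
  then show ?thesis unfolding percolates_def by (intro exI[of _ t]) simp
qed

section \<open>Exploration of a cluster\<close>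

lemma linked_edges_of: "linked r (edges_of w) {u} S \<longleftrightarrow> (\<forall>s\<in>{1..r}. \<exists>x\<in>S. w (s, {u, x}))"
  unfolding linked_def edges_of_def by simp

lemma star_coloured_pairs:
  assumes "S \<subseteq> {1..n}" "u \<in> {1..n}" "u \<notin> S" "s \<in> {1..r}"
  shows "(\<lambda>x. (s, {u, x})) ` S \<subseteq> coloured_pairs n r"
    and "card ((\<lambda>x. (s, {u, x})) ` S) = card S"
proof -
  show "(\<lambda>x. (s, {u, x})) ` S \<subseteq> coloured_pairs n r"
    using assms by (auto simp: coloured_pairs_def vertex_pairs_def card_insert_if)
  show "card ((\<lambda>x. (s, {u, x})) ` S) = card S"
    by (intro card_image) (auto simp: inj_on_def doubleton_eq_iff)
qed

lemma prob_no_neighbour: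
  assumes "S \<subseteq> {1..n}" "u \<in> {1..n}" "u \<notin> S" "s \<in> {1..r}" "0 \<le> q s" "q s \<le> 1"
  shows "measure_pmf.prob (indicator_pmf n r q) {w. \<forall>x\<in>S. \<not> w (s, {u, x})} = (1 - q s) ^ card S"
proof -
  have "measure_pmf.prob (indicator_pmf n r q) {w. \<forall>y\<in>(\<lambda>x. (s, {u, x})) ` S. \<not> w y}
      = (1 - q s) ^ card ((\<lambda>x. (s, {u, x})) ` S)"
    using assms finite_subset[OF assms(1)]
    by (intro prob_indicator_none star_coloured_pairs) auto
  then show ?thesis using star_coloured_pairs(2)[OF assms(1-4)] by simp
qed

lemma prob_neighbour:
  assumes "S \<subseteq> {1..n}" "u \<in> {1..n}" "u \<notin> S" "s \<in> {1..r}" "0 \<le> q s" "q s \<le> 1"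
  shows "measure_pmf.prob (indicator_pmf n r q) {w. \<exists>x\<in>S. w (s, {u, x})} = 1 - (1 - q s) ^ card S"
proof -
  have "measure_pmf.prob (indicator_pmf n r q) {w. \<exists>x\<in>S. w (s, {u, x})}
      = measure_pmf.prob (indicator_pmf n r q) {w. \<not> (\<forall>x\<in>S. \<not> w (s, {u, x}))}"
    by simp
  also have "\<dots> = 1 - (1 - q s) ^ card S"
    by (subst prob_not) (simp only: prob_no_neighbour[of S n u s r q, OF assms])
  finally show ?thesis .
qed

lemma prob_indicator_colours:
  assumes "S \<subseteq> {1..r}" "\<And>s. s \<in> S \<Longrightarrow> determined_by ({s} \<times> UNIV) (Q s)"
  shows "measure_pmf.prob (indicator_pmf n r q) {w. \<forall>s\<in>S. Q s w}
    = (\<Prod>s\<in>S. measure_pmf.prob (indicator_pmf n r q) {w. Q s w})"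
  by (rule prob_indicator_ball[of S "\<lambda>s. {s} \<times> UNIV"])
     (use assms finite_subset[OF assms(1)] in auto)

lemma prob_linked:
  assumes "S \<subseteq> {1..n}" "u \<in> {1..n}" "u \<notin> S" "\<And>s. s \<in> {1..r} \<Longrightarrow> 0 \<le> q s \<and> q s \<le> 1"
  shows "measure_pmf.prob (indicator_pmf n r q) {w. linked r (edges_of w) {u} S}
    = (\<Prod>s\<in>{1..r}. 1 - (1 - q s) ^ card S)"
proof -
  have "measure_pmf.prob (indicator_pmf n r q) {w. linked r (edges_of w) {u} S}
     = (\<Prod>s\<in>{1..r}. measure_pmf.prob (indicator_pmf n r q) {w. \<exists>x\<in>S. w (s, {u, x})})"
    unfolding linked_edges_of
    by (rule prob_indicator_colours) (auto intro!: determined_by_bex determined_by_coordinate)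
  also have "\<dots> = (\<Prod>s\<in>{1..r}. 1 - (1 - q s) ^ card S)"
    using assms by (intro prod.cong prob_neighbour) auto
  finally show ?thesis .
qed

text \<open>The exploration keeps a history \<open>h\<close> of vertices, most recent first, whose first \<open>k\<close> entries
  form the cluster of the current trial. A vertex extends the trial if it is joined to the cluster
  and \<open>hd h\<close> is its only neighbour of colour 1 in the history. The last requirement makes a
  successful test contain all the negative information collected about that vertex before.\<close>

definition extends_trial :: "nat \<Rightarrow> nat list \<Rightarrow> nat \<Rightarrow> nat \<Rightarrow> (nat \<times> nat set \<Rightarrow> bool) \<Rightarrow> bool" where
  "extends_trial r h k u w \<longleftrightarrow> w (1, {u, hd h}) \<and> (\<forall>x\<in>set (tl h). \<not> w (1, {u, x}))
     \<and> (\<forall>s\<in>{2..r}. \<exists>x\<in>set (take k h). w (s, {u, x}))"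

definition pairs_within :: "nat set \<Rightarrow> (nat \<times> nat set) set" where
  "pairs_within A = {(s, e). e \<subseteq> A}"

definition pairs_between :: "nat \<Rightarrow> nat set \<Rightarrow> (nat \<times> nat set) set" where
  "pairs_between u A = {(s, e). \<exists>x\<in>A. e = {u, x}}"

lemma determined_extends_trial:
  assumes "h \<noteq> []"
  shows "determined_by (pairs_between u (set h)) (extends_trial r h k u)"
  unfolding extends_trial_def using assms
  by (intro determined_by_conj determined_by_ball determined_by_bex determined_by_not determined_by_coordinate)
     (auto simp: pairs_between_def dest: in_set_takeD list.set_sel(2))

text \<open>Colour 1 sees the whole history, with one pair present and the others absent; the other
  colours see only the \<open>k\<close> vertices of the current trial. The three groups of pairs are
  disjoint.\<close>

lemma prob_extends_trial:
  assumes h: "distinct h" "set h \<subseteq> {1..n}" "h \<noteq> []" "k \<le> length h" and u: "u \<in> {1..n}" "u \<notin> set h"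
    and r: "1 \<le> r" and q: "\<And>s. s \<in> {1..r} \<Longrightarrow> 0 \<le> q s \<and> q s \<le> 1"
  shows "measure_pmf.prob (indicator_pmf n r q) {w. extends_trial r h k u w}
    = q 1 * (1 - q 1) ^ (length h - 1) * (\<Prod>s\<in>{2..r}. 1 - (1 - q s) ^ k)"
proof -
  let ?pr = "\<lambda>Q. measure_pmf.prob (indicator_pmf n r q) {w. Q w}"
  obtain x t where ht: "h = x # t" using h(3) by (cases h) auto
  have 1: "?pr (\<lambda>w. w (1, {u, x}) \<and> (\<forall>y\<in>set t. \<not> w (1, {u, y}))) = q 1 * (1 - q 1) ^ (length h - 1)"
  proof -
    have "?pr (\<lambda>w. w (1, {u, x}) \<and> (\<forall>y\<in>set t. \<not> w (1, {u, y})))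
      = ?pr (\<lambda>w. w (1, {u, x})) * ?pr (\<lambda>w. \<forall>y\<in>set t. \<not> w (1, {u, y}))"
      using h(1) ht u
      by (intro prob_indicator_conj[of "{(1, {u, x})}" _ "pairs_between u (set t)"]
           determined_by_ball determined_by_not determined_by_coordinate)
         (auto simp: pairs_between_def doubleton_eq_iff)
    also have "?pr (\<lambda>w. w (1, {u, x})) = q (fst (1, {u, x}))"
      using h(2) ht u r q[of 1]
      by (intro prob_indicator_coordinate) (auto simp: coloured_pairs_def vertex_pairs_def card_insert_if)
    also have "?pr (\<lambda>w. \<forall>y\<in>set t. \<not> w (1, {u, y})) = (1 - q 1) ^ card (set t)"
      using h ht u r q[of 1] by (intro prob_no_neighbour) auto
    finally show ?thesis using h(1) ht by (simp add: distinct_card)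
  qed
  have 2: "?pr (\<lambda>w. \<forall>s\<in>{2..r}. \<exists>x\<in>set (take k h). w (s, {u, x})) = (\<Prod>s\<in>{2..r}. 1 - (1 - q s) ^ k)"
  proof -
    have "?pr (\<lambda>w. \<forall>s\<in>{2..r}. \<exists>x\<in>set (take k h). w (s, {u, x}))
      = (\<Prod>s\<in>{2..r}. ?pr (\<lambda>w. \<exists>x\<in>set (take k h). w (s, {u, x})))"
      by (rule prob_indicator_colours) (auto intro!: determined_by_bex determined_by_coordinate)
    also have "\<dots> = (\<Prod>s\<in>{2..r}. 1 - (1 - q s) ^ card (set (take k h)))"
      using h u q by (intro prod.cong prob_neighbour) (auto dest: in_set_takeD)
    also have "card (set (take k h)) = k" using h by (simp add: distinct_card)
    finally show ?thesis .
  qed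
  have "?pr (extends_trial r h k u) = ?pr (\<lambda>w. (w (1, {u, x}) \<and> (\<forall>y\<in>set t. \<not> w (1, {u, y})))
     \<and> (\<forall>s\<in>{2..r}. \<exists>x\<in>set (take k h). w (s, {u, x})))"
    unfolding extends_trial_def ht by (simp add: conj_assoc)
  also have "\<dots> = ?pr (\<lambda>w. w (1, {u, x}) \<and> (\<forall>y\<in>set t. \<not> w (1, {u, y})))
     * ?pr (\<lambda>w. \<forall>s\<in>{2..r}. \<exists>x\<in>set (take k h). w (s, {u, x}))"
    by (intro prob_indicator_conj[of "{1} \<times> UNIV" _ "{2..r} \<times> UNIV"]
         determined_by_conj determined_by_ball determined_by_bex determined_by_not determined_by_coordinate)
       auto
  finally show ?thesis unfolding 1 2 .
qed

text \<open>\<open>F\<close> is what is known about the pairs inside the history, and \<open>G u\<close> what is known about the pairs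
  between an unexplored vertex \<open>u\<close> and the history; \<open>T\<close> is the number of further trials.\<close>

lemma exploration:
  fixes a s :: "nat \<Rightarrow> real"
  assumes r: "1 \<le> r" and q: "\<And>s. s \<in> {1..r} \<Longrightarrow> 0 \<le> q s \<and> q s \<le> 1"
    and a: "\<And>k. 1 \<le> k \<Longrightarrow> 0 \<le> a k \<and> a k \<le> q 1 * (1 - q 1) ^ H * (\<Prod>s\<in>{2..r}. 1 - (1 - q s) ^ k)"
    and s: "\<And>k. 1 \<le> k \<Longrightarrow> 0 \<le> s k \<and> s k \<le> 1 \<and> (1 - a k) ^ (n - H) \<le> 1 - s k"
    and H: "H \<le> n"
    and h: "distinct h" "set h \<subseteq> {1..n}" "1 \<le> k" "k \<le> length h" "k \<le> K"
      "length h + (K - k) + T * K \<le> H"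
    and F: "determined_by (pairs_within (set h)) F"
      "\<And>w. F w \<Longrightarrow> spanned r (edges_of w) (set (take k h))"
    and G: "\<And>u. u \<in> {1..n} - set h \<Longrightarrow> determined_by (pairs_between u (set (tl h))) (G u)"
      "\<And>u w. u \<in> {1..n} - set h \<Longrightarrow> (\<forall>x\<in>set (tl h). \<not> w (1, {u, x})) \<Longrightarrow> G u w"
  shows "measure_pmf.prob (indicator_pmf n r q)
      {w. (F w \<and> (\<forall>u\<in>{1..n} - set h. G u w))
        \<and> \<not> (\<exists>S\<subseteq>{1..n}. spanned r (edges_of w) S \<and> card S = K)}
    \<le> measure_pmf.prob (indicator_pmf n r q) {w. F w \<and> (\<forall>u\<in>{1..n} - set h. G u w)}
      * (1 - (\<Prod>j\<in>{k..<K}. s j)) * (1 - (\<Prod>j\<in>{1..<K}. s j)) ^ T"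
  using h F G
\<comment> \<open>Extending the trial lowers \<open>K - k\<close>. Abandoning it resets this term to
  \<open>K - 1\<close> but consumes one of \<open>T\<close>, whose weight \<open>K + 1\<close>
  outweighs the reset.\<close>
proof (induction "T * (K + 1) + (K - k)" arbitrary: T k h F G rule: less_induct)
  case (less T k h F G)
  let ?pr = "\<lambda>Q. measure_pmf.prob (indicator_pmf n r q) {w. Q w}"
  let ?Z = "\<lambda>k. \<Prod>j\<in>{k..<K}. s j"
  let ?succ = "\<lambda>w. \<exists>S\<subseteq>{1..n}. spanned r (edges_of w) S \<and> card S = K"
  let ?ext = "extends_trial r h k"
  define U where "U = {1..n} - set h"
  define EF where "EF = (\<lambda>w. F w \<and> (\<forall>u\<in>U. G u w))"
  have Z01: "0 \<le> ?Z k \<and> ?Z k \<le> 1" if "1 \<le> k" for k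
    using s that by (auto intro!: prod_nonneg prod_le_1)
  have hne: "h \<noteq> []" using less.prems(3,4) by auto
  have hdtl: "set h = insert (hd h) (set (tl h))" using hne by (cases h) auto
  show ?case
  proof (cases "k = K")
    case True
    have "?succ w" if "F w" for w
      using less.prems(1,2,4) True less.prems(8)[OF that]
      by (intro exI[of _ "set (take k h)"]) (auto simp: distinct_card dest: in_set_takeD)
    then have "{w. (F w \<and> (\<forall>u\<in>{1..n} - set h. G u w)) \<and> \<not> ?succ w} = {}" by blast
    then have "?pr (\<lambda>w. (F w \<and> (\<forall>u\<in>{1..n} - set h. G u w)) \<and> \<not> ?succ w) = 0"
      by (simp only: measure_empty)
    also have "\<dots> \<le> ?pr (\<lambda>w. F w \<and> (\<forall>u\<in>{1..n} - set h. G u w)) * (1 - ?Z k) * (1 - ?Z 1) ^ T"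
      using Z01[of k] Z01[of 1] less.prems(3) by (intro mult_nonneg_nonneg zero_le_power) auto
    finally show ?thesis .
  next
    case False
    then have kK: "k < K" using less.prems by simp
    define none where "none = (\<lambda>w. \<forall>u\<in>U. \<not> ?ext u w)"
    \<comment> \<open>Choosing the least extending vertex makes the events disjoint, so that their
      probabilities may be added in \<open>firsts\<close>.\<close>
    define first where "first = (\<lambda>u w. ?ext u w \<and> (\<forall>v\<in>U. v < u \<longrightarrow> \<not> ?ext v w))"
    have finU: "finite U" unfolding U_def by simp
    \<comment> \<open>\<open>H\<close> is a budget for the history over all remaining trials. It
      guarantees at least \<open>n - H\<close> candidates, each with at most \<open>H\<close>
      forbidden neighbours.\<close>
    have hH: "length h < H" using less.prems(6) kK by linarith
    have cardU: "card U = n - length h"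
      using less.prems(1,2) unfolding U_def by (simp add: card_Diff_subset distinct_card)
    have UU: "u \<in> {1..n} - set h" if "u \<in> U" for u using that by (simp add: U_def)
    have detF: "determined_by (pairs_within (set (u # h))) F" for u
      using less.prems(7) by (rule determined_by_mono) (auto simp: pairs_within_def)
    have detG: "determined_by (pairs_between u (set h)) (G u)" if "u \<in> U" for u
      using less.prems(9)[OF UU[OF that]] by (rule determined_by_mono) (auto simp: pairs_between_def hdtl)
    have detE: "determined_by (pairs_between u (set h)) (?ext u)" for u
      using hne by (rule determined_extends_trial)
    have sub: "pairs_between u (set h) \<subseteq> pairs_within (set (u # h))" for u
      by (auto simp: pairs_between_def pairs_within_def)
    \<comment> \<open>This preserves the hypothesis on \<open>G\<close> when the history grows by
      one vertex: a vertex without colour 1 neighbours in \<open>h\<close> fails the present test,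
      so the new negative information is again implied by the absence of colour 1
      neighbours.\<close>
    have quiet: "G v w \<and> \<not> ?ext v w" if "v \<in> U" "\<forall>x\<in>set h. \<not> w (1, {v, x})" for v w
      using that less.prems(10)[OF UU[OF that(1)], of w] hdtl by (auto simp: extends_trial_def)
    have step_first: "?pr (\<lambda>w. (EF w \<and> first u w) \<and> \<not> ?succ w)
        \<le> ?pr (\<lambda>w. EF w \<and> first u w) * (1 - ?Z (Suc k)) * (1 - ?Z 1) ^ T" if u: "u \<in> U" for u
    proof -
      let ?F = "\<lambda>w. F w \<and> G u w \<and> ?ext u w"
      \<comment> \<open>That \<open>u\<close> comes first reveals a failed test only for the smaller
        vertices.\<close>
      let ?G = "\<lambda>v w. G v w \<and> (v < u \<longrightarrow> \<not> ?ext v w)"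
      have U': "{1..n} - set (u # h) = U - {u}" by (auto simp: U_def)
      have eq: "(?F w \<and> (\<forall>v\<in>{1..n} - set (u # h). ?G v w)) \<longleftrightarrow> (EF w \<and> first u w)" for w
        unfolding U' EF_def first_def using u by blast
      have "?pr (\<lambda>w. (?F w \<and> (\<forall>v\<in>{1..n} - set (u # h). ?G v w)) \<and> \<not> ?succ w)
        \<le> ?pr (\<lambda>w. ?F w \<and> (\<forall>v\<in>{1..n} - set (u # h). ?G v w))
          * (1 - ?Z (Suc k)) * (1 - ?Z 1) ^ T"
      proof (rule less.hyps)
        show "T * (K + 1) + (K - Suc k) < T * (K + 1) + (K - k)" using kK by simp
        show "distinct (u # h)" "set (u # h) \<subseteq> {1..n}" "1 \<le> Suc k" "Suc k \<le> length (u # h)" "Suc k \<le> K"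
          "length (u # h) + (K - Suc k) + T * K \<le> H"
          using u less.prems kK by (auto simp: U_def)
        show "determined_by (pairs_within (set (u # h))) ?F"
          using detF determined_by_mono[OF detG[OF u] sub] determined_by_mono[OF detE sub]
          by (intro determined_by_conj)
        show "spanned r (edges_of w) (set (take (Suc k) (u # h)))" if w: "?F w" for w
        proof -
          have "hd h \<in> set (take k h)" using hne less.prems(3) by (cases h; cases k) auto
          then have "\<exists>x\<in>set (take k h). w (c, {u, x})" if "c \<in> {1..r}" for c
            using w that unfolding extends_trial_def by (cases "c = 1") auto
          then have "linked r (edges_of w) {u} (set (take k h))" unfolding linked_edges_of by blast
          moreover have "u \<notin> set (take k h)" using u by (auto simp: U_def dest: in_set_takeD)
          ultimately show ?thesis using less.prems(8)[of w] w by (simp add: spanned_insert)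
        qed
        fix v assume v: "v \<in> {1..n} - set (u # h)"
        then have vU: "v \<in> U" by (auto simp: U_def)
        show "determined_by (pairs_between v (set (tl (u # h)))) (?G v)"
          using detG[OF vU] detE
          by (intro determined_by_conj determined_by_imp determined_by_not) (auto simp: determined_by_def)
        show "?G v w" if "\<forall>x\<in>set (tl (u # h)). \<not> w (1, {v, x})" for w
          using quiet[OF vU, of w] that by simp
      qed
      then show ?thesis unfolding eq .
    qed
    have step_none: "?pr (\<lambda>w. (EF w \<and> none w) \<and> \<not> ?succ w) \<le> ?pr (\<lambda>w. EF w \<and> none w) * (1 - ?Z 1) ^ T"
    proof (cases T)
      case 0
      show ?thesis unfolding 0 power_0 mult_1_right by (rule prob_mono) simp
    next
      case (Suc T')
      have "U \<noteq> {}" using cardU hH H by auto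
      then obtain u where u: "u \<in> U" by auto
      \<comment> \<open>The next trial starts at an arbitrary unexplored \<open>u\<close>. Its
        failed test moves into \<open>?F\<close>, since its pairs to \<open>h\<close> now lie inside
        the history; the cluster restarts as \<open>{u}\<close>.\<close>
      let ?F = "\<lambda>w. F w \<and> G u w \<and> \<not> ?ext u w"
      let ?G = "\<lambda>v w. G v w \<and> \<not> ?ext v w"
      have U': "{1..n} - set (u # h) = U - {u}" by (auto simp: U_def)
      have eq: "(?F w \<and> (\<forall>v\<in>{1..n} - set (u # h). ?G v w)) \<longleftrightarrow> (EF w \<and> none w)" for w
        unfolding U' EF_def none_def using u by blast
      have "?pr (\<lambda>w. (?F w \<and> (\<forall>v\<in>{1..n} - set (u # h). ?G v w)) \<and> \<not> ?succ w)
        \<le> ?pr (\<lambda>w. ?F w \<and> (\<forall>v\<in>{1..n} - set (u # h). ?G v w))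
          * (1 - ?Z 1) * (1 - ?Z 1) ^ T'"
      proof (rule less.hyps)
        show "T' * (K + 1) + (K - 1) < T * (K + 1) + (K - k)" unfolding Suc using kK by simp
        show "distinct (u # h)" "set (u # h) \<subseteq> {1..n}" "1 \<le> (1::nat)" "1 \<le> length (u # h)" "1 \<le> K"
          "length (u # h) + (K - 1) + T' * K \<le> H"
          using u less.prems kK Suc by (auto simp: U_def)
        show "determined_by (pairs_within (set (u # h))) ?F"
          using detF determined_by_mono[OF detG[OF u] sub] determined_by_mono[OF detE sub]
          by (intro determined_by_conj determined_by_not)
        show "spanned r (edges_of w) (set (take 1 (u # h)))" for w
          by (simp add: spanned.single)
        fix v assume v: "v \<in> {1..n} - set (u # h)"
        then have vU: "v \<in> U" by (auto simp: U_def)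
        show "determined_by (pairs_between v (set (tl (u # h)))) (?G v)"
          using detG[OF vU] detE
          by (intro determined_by_conj determined_by_not) simp_all
        show "?G v w" if "\<forall>x\<in>set (tl (u # h)). \<not> w (1, {v, x})" for w
          using quiet[OF vU, of w] that by simp
      qed
      then show ?thesis unfolding eq Suc by (simp add: mult.assoc)
    qed
    have none_le: "?pr (\<lambda>w. EF w \<and> none w) \<le> ?pr EF * (1 - s k)"
    proof -
      have disj: "pairs_within (set h) \<inter> (\<Union>u\<in>U. pairs_between u (set h)) = {}"
        by (auto simp: pairs_within_def pairs_between_def U_def)
      have disj': "pairs_between u (set h) \<inter> pairs_between v (set h) = {}"
        if "u \<in> U" "v \<in> U" "u \<noteq> v" for u v
        using that by (auto simp: pairs_between_def U_def doubleton_eq_iff)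
      have prod: "?pr (\<lambda>w. F w \<and> (\<forall>u\<in>U. R u w)) = ?pr F * (\<Prod>u\<in>U. ?pr (R u))"
        if R: "\<And>u. u \<in> U \<Longrightarrow> determined_by (pairs_between u (set h)) (R u)" for R
      proof -
        have "?pr (\<lambda>w. F w \<and> (\<forall>u\<in>U. R u w)) = ?pr F * ?pr (\<lambda>w. \<forall>u\<in>U. R u w)"
        proof (rule prob_indicator_conj[OF less.prems(7) _ disj])
          show "determined_by (\<Union>u\<in>U. pairs_between u (set h)) (\<lambda>w. \<forall>u\<in>U. R u w)"
            by (intro determined_by_ball determined_by_mono[OF R]) auto
        qed
        also have "?pr (\<lambda>w. \<forall>u\<in>U. R u w) = (\<Prod>u\<in>U. ?pr (R u))"
          using finU R disj' by (rule prob_indicator_ball)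
        finally show ?thesis .
      qed
      have ak: "0 \<le> a k" "a k \<le> 1"
      proof -
        show "0 \<le> a k" using a[of k] less.prems(3) by simp
        have "(\<Prod>c\<in>{2..r}. 1 - (1 - q c) ^ k) \<le> 1"
          using q by (intro prod_le_1) (auto intro!: power_le_one)
        moreover have "0 \<le> (\<Prod>c\<in>{2..r}. 1 - (1 - q c) ^ k)"
          using q by (intro prod_nonneg) (auto intro!: power_le_one)
        moreover have "q 1 * (1 - q 1) ^ H \<le> 1"
          using q[of 1] r by (intro mult_le_one power_le_one zero_le_power) auto
        ultimately have "q 1 * (1 - q 1) ^ H * (\<Prod>c\<in>{2..r}. 1 - (1 - q c) ^ k) \<le> 1"
          by (metis mult_le_one)
        then show "a k \<le> 1" using a[of k] less.prems(3) by linarith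
      qed
      have each: "?pr (\<lambda>w. G u w \<and> \<not> ?ext u w) \<le> ?pr (G u) * (1 - a k)" if u: "u \<in> U" for u
      proof -
        have ge: "a k \<le> ?pr (?ext u)"
        proof -
          have "?pr (?ext u) = q 1 * (1 - q 1) ^ (length h - 1) * (\<Prod>c\<in>{2..r}. 1 - (1 - q c) ^ k)"
            using u less.prems(1,2,4) hne r q by (intro prob_extends_trial) (auto simp: U_def)
          also have "\<dots> \<ge> q 1 * (1 - q 1) ^ H * (\<Prod>c\<in>{2..r}. 1 - (1 - q c) ^ k)"
            using q[of 1] r q hH
            by (intro mult_right_mono mult_left_mono power_decreasing prod_nonneg) (auto intro!: power_le_one)
          finally show ?thesis using a[of k] less.prems(3) by linarith
        qed
        have "?pr (G u) = ?pr (\<lambda>w. G u w \<and> ?ext u w) + ?pr (\<lambda>w. G u w \<and> \<not> ?ext u w)"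
          by (rule prob_split)
        \<comment> \<open>The strength of the test pays off: it forbids colour 1 neighbours in
          \<open>tl h\<close> and hence implies \<open>G u\<close>. Conditioning on the past can
          therefore only raise the success probability.\<close>
        moreover have "(G u w \<and> ?ext u w) = ?ext u w" for w
          using less.prems(10)[OF UU[OF u], of w] by (auto simp: extends_trial_def)
        moreover have "?pr (G u) * a k \<le> a k"
          using ak by (intro mult_left_le_one_le) auto
        ultimately show ?thesis using ge by (simp add: algebra_simps)
      qed
      have "?pr (\<lambda>w. EF w \<and> none w) = ?pr (\<lambda>w. F w \<and> (\<forall>u\<in>U. G u w \<and> \<not> ?ext u w))"
        unfolding EF_def none_def by (rule arg_cong[where f="measure_pmf.prob _"]) blast
      also have "\<dots> = ?pr F * (\<Prod>u\<in>U. ?pr (\<lambda>w. G u w \<and> \<not> ?ext u w))"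
        using detG detE by (intro prod determined_by_conj determined_by_not)
      also have "\<dots> \<le> ?pr F * (\<Prod>u\<in>U. ?pr (G u) * (1 - a k))"
        using each by (intro mult_left_mono prod_mono) auto
      also have "\<dots> = ?pr F * (\<Prod>u\<in>U. ?pr (G u)) * (1 - a k) ^ card U"
        by (simp add: prod.distrib)
      also have "?pr F * (\<Prod>u\<in>U. ?pr (G u)) = ?pr EF"
        unfolding EF_def using detG by (intro prod[symmetric])
      also have "?pr EF * (1 - a k) ^ card U \<le> ?pr EF * (1 - a k) ^ (n - H)"
        using ak hH unfolding cardU by (intro mult_left_mono power_decreasing) auto
      also have "\<dots> \<le> ?pr EF * (1 - s k)"
        using s[of k] less.prems(3) by (intro mult_left_mono) auto
      finally show ?thesis .
    qed
    have firsts: "(\<Sum>u\<in>U. ?pr (\<lambda>w. EF w \<and> first u w)) \<le> ?pr EF - ?pr (\<lambda>w. EF w \<and> none w)"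
    proof -
      have "(\<Sum>u\<in>U. ?pr (\<lambda>w. EF w \<and> first u w)) = measure_pmf.prob (indicator_pmf n r q) (\<Union>u\<in>U. {w. EF w \<and> first u w})"
        using finU
      proof (intro measure_pmf.finite_measure_finite_Union[symmetric])
        show "disjoint_family_on (\<lambda>u. {w. EF w \<and> first u w}) U"
          unfolding disjoint_family_on_def first_def by (auto dest: linorder_neqE_nat)
      qed auto
      also have "\<dots> \<le> ?pr (\<lambda>w. EF w \<and> \<not> none w)"
        by (intro measure_pmf.finite_measure_mono) (auto simp: first_def none_def)
      also have "\<dots> = ?pr EF - ?pr (\<lambda>w. EF w \<and> none w)"
        using prob_split[of "indicator_pmf n r q" EF none] by simp
      finally show ?thesis .
    qed
    let ?Y = "(1 - ?Z 1) ^ T"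
    have Y: "0 \<le> ?Y" using Z01[of 1] by simp
    have Z': "0 \<le> ?Z (Suc k)" "?Z (Suc k) \<le> 1" using Z01[of "Suc k"] by auto
    have cover: "(\<exists>u\<in>U. first u w) \<or> none w" for w
    proof (rule disjCI)
      assume "\<not> none w"
      then have ex: "\<exists>u. u \<in> U \<and> ?ext u w" by (auto simp: none_def)
      define m where "m = (LEAST u. u \<in> U \<and> ?ext u w)"
      have "m \<in> U \<and> ?ext m w" unfolding m_def using ex by (rule LeastI_ex)
      moreover have "\<not> ?ext v w" if "v \<in> U" "v < m" for v
        using that not_less_Least unfolding m_def by blast
      ultimately show "\<exists>u\<in>U. first u w" unfolding first_def by blast
    qed
    have "?pr (\<lambda>w. EF w \<and> \<not> ?succ w)
      \<le> ?pr (\<lambda>w. (\<exists>u\<in>U. (EF w \<and> first u w) \<and> \<not> ?succ w) \<or> ((EF w \<and> none w) \<and> \<not> ?succ w))"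
      using cover by (intro prob_mono) blast
    also have "\<dots> \<le> ?pr (\<lambda>w. \<exists>u\<in>U. (EF w \<and> first u w) \<and> \<not> ?succ w) + ?pr (\<lambda>w. (EF w \<and> none w) \<and> \<not> ?succ w)"
      by (subst Collect_disj_eq, rule measure_Un_le) auto
    also have "\<dots> \<le> (\<Sum>u\<in>U. ?pr (\<lambda>w. (EF w \<and> first u w) \<and> \<not> ?succ w)) + ?pr (\<lambda>w. EF w \<and> none w) * ?Y"
      using step_none finU by (intro add_mono prob_union_bound)
    also have "\<dots> \<le> (\<Sum>u\<in>U. ?pr (\<lambda>w. EF w \<and> first u w) * (1 - ?Z (Suc k)) * ?Y) + ?pr (\<lambda>w. EF w \<and> none w) * ?Y"
      using step_first by (intro add_right_mono sum_mono)
    also have "\<dots> = (\<Sum>u\<in>U. ?pr (\<lambda>w. EF w \<and> first u w)) * ((1 - ?Z (Suc k)) * ?Y) + ?pr (\<lambda>w. EF w \<and> none w) * ?Y"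
      by (simp add: sum_distrib_right mult.assoc)
    also have "\<dots> \<le> (?pr EF - ?pr (\<lambda>w. EF w \<and> none w)) * ((1 - ?Z (Suc k)) * ?Y) + ?pr (\<lambda>w. EF w \<and> none w) * ?Y"
      using firsts Y Z' by (intro add_right_mono mult_right_mono) auto
    also have "\<dots> = (?pr EF * (1 - ?Z (Suc k)) + ?pr (\<lambda>w. EF w \<and> none w) * ?Z (Suc k)) * ?Y"
      by (simp add: algebra_simps)
    \<comment> \<open>After collecting terms the bound increases with the probability of
      \<open>none\<close>, so the upper bound \<open>none_le\<close> may be inserted. What remains
      is the product recursion for \<open>?Z\<close>.\<close>
    also have "\<dots> \<le> (?pr EF * (1 - ?Z (Suc k)) + ?pr EF * (1 - s k) * ?Z (Suc k)) * ?Y"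
      using none_le Y Z' by (intro mult_right_mono add_left_mono) auto
    also have "\<dots> = ?pr EF * (1 - s k * ?Z (Suc k)) * ?Y"
      by (simp add: algebra_simps)
    also have "s k * ?Z (Suc k) = ?Z k"
      using kK by (simp add: prod.atLeast_Suc_lessThan)
    finally show ?thesis unfolding EF_def U_def .
  qed
qed

text \<open>Vertex 1 alone, with nothing revealed, is the first of the \<open>T\<close> trials; its
  failure factor joins those of the remaining \<open>T - 1\<close>.\<close>

lemma exploration_start:
  fixes a s :: "nat \<Rightarrow> real"
  assumes r: "1 \<le> r" and q: "\<And>s. s \<in> {1..r} \<Longrightarrow> 0 \<le> q s \<and> q s \<le> 1"
    and a: "\<And>k. 1 \<le> k \<Longrightarrow> 0 \<le> a k \<and> a k \<le> q 1 * (1 - q 1) ^ H * (\<Prod>s\<in>{2..r}. 1 - (1 - q s) ^ k)"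
    and s: "\<And>k. 1 \<le> k \<Longrightarrow> 0 \<le> s k \<and> s k \<le> 1 \<and> (1 - a k) ^ (n - H) \<le> 1 - s k"
    and H: "H \<le> n" "T * K \<le> H" and K: "1 \<le> K" and T: "1 \<le> T"
  shows "measure_pmf.prob (indicator_pmf n r q)
      {w. \<not> (\<exists>S\<subseteq>{1..n}. spanned r (edges_of w) S \<and> card S = K)}
    \<le> (1 - (\<Prod>j\<in>{1..<K}. s j)) ^ T"
proof -
  obtain T' where T': "T = Suc T'" using T by (cases T) auto
  have "1 * 1 \<le> T * K" using K T by (intro mult_le_mono)
  then have n: "1 \<le> n" using H by linarith
  have "measure_pmf.prob (indicator_pmf n r q)
      {w. (True \<and> (\<forall>u\<in>{1..n} - set [1]. True))
        \<and> \<not> (\<exists>S\<subseteq>{1..n}. spanned r (edges_of w) S \<and> card S = K)}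
    \<le> measure_pmf.prob (indicator_pmf n r q) {w. True \<and> (\<forall>u\<in>{1..n} - set [1]. True)}
      * (1 - (\<Prod>j\<in>{1..<K}. s j)) * (1 - (\<Prod>j\<in>{1..<K}. s j)) ^ T'"
  proof (rule exploration[where a=a and H=H, OF r q a s])
    show "length [1] + (K - 1) + T' * K \<le> H" using H K T' by simp
    show "spanned r (edges_of w) (set (take 1 [1]))" for w by (simp add: spanned.single)
  qed (use H K n in \<open>simp_all add: determined_by_def\<close>)
  then show ?thesis by (simp add: T')
qed

section \<open>Stuck sets\<close>

lemma one_minus_power_le_exp:
  fixes x :: real
  assumes "0 \<le> x" "x \<le> 1"
  shows "(1 - x) ^ k \<le> exp (- (real k * x))"
proof -
  have "(1 - x) ^ k \<le> exp (- x) ^ k"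
    using assms exp_ge_add_one_self[of "- x"] by (intro power_mono) auto
  also have "\<dots> = exp (- (real k * x))" by (simp add: exp_of_nat_mult[symmetric])
  finally show ?thesis .
qed

text \<open>First-moment bound over all sets of each size. For fixed \<open>S\<close> the stars from
  the \<open>n - k\<close> outside vertices to \<open>S\<close> are disjoint, which gives the
  exponent.\<close>

lemma prob_stuck_le:
  assumes q: "\<And>s. s \<in> {1..r} \<Longrightarrow> 0 \<le> q s \<and> q s \<le> 1"
  shows "measure_pmf.prob (indicator_pmf n r q)
      {w. \<exists>S. k\<^sub>0 \<le> card S \<and> stuck {1..n} r (edges_of w) S}
    \<le> (\<Sum>k\<in>{k\<^sub>0..<n}. real (n choose k) * (1 - (\<Prod>s\<in>{1..r}. 1 - (1 - q s) ^ k)) ^ (n - k))"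
proof -
  let ?pr = "\<lambda>Q. measure_pmf.prob (indicator_pmf n r q) {w. Q w}"
  let ?b = "\<lambda>k. \<Prod>s\<in>{1..r}. 1 - (1 - q s) ^ k"
  let ?B = "\<lambda>k. {S. S \<subseteq> {1..n} \<and> card S = k}"
  let ?none = "\<lambda>S w. \<forall>u\<in>{1..n} - S. \<not> linked r (edges_of w) {u} S"
  have single: "?pr (?none S) = (1 - ?b k) ^ (n - k)" if "S \<in> ?B k" for S k
  proof -
    have S: "S \<subseteq> {1..n}" "card S = k" using that by auto
    have "?pr (?none S) = (\<Prod>u\<in>{1..n} - S. ?pr (\<lambda>w. \<not> linked r (edges_of w) {u} S))"
    proof (rule prob_indicator_ball[where B = "\<lambda>u. pairs_between u S"])
      fix u v assume "u \<in> {1..n} - S" "v \<in> {1..n} - S" "u \<noteq> v"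
      then show "pairs_between u S \<inter> pairs_between v S = {}"
        by (auto simp: pairs_between_def doubleton_eq_iff)
    next
      fix u
      show "determined_by (pairs_between u S) (\<lambda>w. \<not> linked r (edges_of w) {u} S)"
        unfolding linked_edges_of
        by (intro determined_by_not determined_by_ball determined_by_bex determined_by_coordinate)
           (auto simp: pairs_between_def)
    qed simp
    also have "\<dots> = (\<Prod>u\<in>{1..n} - S. 1 - ?b k)"
    proof (rule prod.cong[OF refl])
      fix u assume "u \<in> {1..n} - S"
      then show "?pr (\<lambda>w. \<not> linked r (edges_of w) {u} S) = 1 - ?b k"
        using prob_linked[of S n u r q] S q by (subst prob_not) auto
    qed
    also have "\<dots> = (1 - ?b k) ^ (n - k)"
      using S finite_subset[OF S(1)] by (simp add: card_Diff_subset)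
    finally show ?thesis .
  qed
  have "?pr (\<lambda>w. \<exists>S. k\<^sub>0 \<le> card S \<and> stuck {1..n} r (edges_of w) S)
    \<le> ?pr (\<lambda>w. \<exists>k\<in>{k\<^sub>0..<n}. \<exists>S\<in>?B k. ?none S w)"
  proof (rule prob_mono)
    fix w assume "\<exists>S. k\<^sub>0 \<le> card S \<and> stuck {1..n} r (edges_of w) S"
    then obtain S where S: "k\<^sub>0 \<le> card S" "S \<subseteq> {1..n}" "S \<noteq> {1..n}" "?none S w"
      by (auto simp: stuck_def)
    then have "card S < n" using psubset_card_mono[of "{1..n}" S] by auto
    then show "\<exists>k\<in>{k\<^sub>0..<n}. \<exists>S\<in>?B k. ?none S w"
      using S by (intro bexI[of _ "card S"] bexI[of _ S]) auto
  qed
  also have "\<dots> \<le> (\<Sum>k\<in>{k\<^sub>0..<n}. ?pr (\<lambda>w. \<exists>S\<in>?B k. ?none S w))"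
    by (intro prob_union_bound) simp
  also have "\<dots> \<le> (\<Sum>k\<in>{k\<^sub>0..<n}. \<Sum>S\<in>?B k. ?pr (?none S))"
    by (intro sum_mono prob_union_bound) simp
  also have "\<dots> = (\<Sum>k\<in>{k\<^sub>0..<n}. real (n choose k) * (1 - ?b k) ^ (n - k))"
  proof (rule sum.cong[OF refl])
    fix k
    have "(\<Sum>S\<in>?B k. ?pr (?none S)) = (\<Sum>S\<in>?B k. (1 - ?b k) ^ (n - k))"
      by (rule sum.cong[OF refl single])
    then show "(\<Sum>S\<in>?B k. ?pr (?none S)) = real (n choose k) * (1 - ?b k) ^ (n - k)"
      by (simp add: n_subsets)
  qed
  finally show ?thesis .
qed

text \<open>Every size contributes at most \<open>1 / n^2\<close>. Up to \<open>n / 2\<close>, the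
  \<open>n^k\<close> choices of the set are beaten by a failure probability of at most
  \<open>n^(-3 * k)\<close>; beyond \<open>n / 2\<close>, the complement is counted instead, and
  each of its vertices fails with probability at most \<open>n^(-3)\<close>.\<close>

lemma stuck_bound:
  fixes q :: "nat \<Rightarrow> real" and C :: real
  assumes n: "2 \<le> n" "r \<le> n" and r: "1 \<le> r" and k0: "1 \<le> k\<^sub>0"
    and q: "\<And>s. s \<in> {1..r} \<Longrightarrow> 0 \<le> q s \<and> q s \<le> 1"
    and min: "\<And>s. s \<in> {1..r} \<Longrightarrow> q 1 \<le> q s"
    and C: "2 ^ (2 * r + 4) \<le> C" "C * ln (real n) \<le> real n * q 1"
    and small: "\<And>k. k\<^sub>0 \<le> k \<Longrightarrow> 2 * k \<le> n \<Longrightarrow> real k * q 1 < 1 \<Longrightarrow>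
      6 * real k * ln (real n) \<le> real n * (\<Prod>s\<in>{1..r}. 1 - (1 - q s) ^ k)"
  shows "measure_pmf.prob (indicator_pmf n r q)
      {w. \<exists>S. k\<^sub>0 \<le> card S \<and> stuck {1..n} r (edges_of w) S} \<le> 1 / real n"
proof -
  define l where "l = ln (real n)"
  have l: "0 < l" "exp l = real n" using n by (auto simp: l_def)
  have powl: "real n ^ k = exp (real k * l)" for k using l(2) by (simp add: exp_of_nat_mult)
  let ?b = "\<lambda>k. \<Prod>s\<in>{1..r}. 1 - (1 - q s) ^ k"
  have q1: "0 \<le> q 1" "q 1 \<le> 1" using q[of 1] r by auto
  have b01: "0 \<le> ?b k" "?b k \<le> 1" for k
    using q by (auto intro!: prod_nonneg prod_le_1 power_le_one)
  have bge: "(1 - exp (- (real k * q 1))) ^ r \<le> ?b k" for k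
  proof -
    have "(\<Prod>s\<in>{1..r}. 1 - exp (- (real k * q 1))) \<le> ?b k"
    proof (intro prod_mono conjI)
      fix s assume s: "s \<in> {1..r}"
      show "0 \<le> 1 - exp (- (real k * q 1))" using q1 by simp
      have "(1 - q s) ^ k \<le> (1 - q 1) ^ k" using min[OF s] q[OF s] by (intro power_mono) auto
      also have "\<dots> \<le> exp (- (real k * q 1))" using q1 by (rule one_minus_power_le_exp)
      finally show "1 - exp (- (real k * q 1)) \<le> 1 - (1 - q s) ^ k" by simp
    qed
    then show ?thesis by simp
  qed
  have bern: "1 - ?b k \<le> real r * exp (- (real k * q 1))" for k
  proof -
    have "1 + real r * (- exp (- (real k * q 1))) \<le> (1 + (- exp (- (real k * q 1)))) ^ r"
      using q1 by (intro Bernoulli_inequality) simp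
    then show ?thesis using bge[of k] by simp
  qed
  have term_le: "real (n choose k) * (1 - ?b k) ^ (n - k) \<le> exp (- 2 * l)" if k: "k \<in> {k\<^sub>0..<n}" for k
  proof (cases "2 * k \<le> n")
    case True
    have k1: "1 \<le> k" using k k0 by auto
    \<comment> \<open>\<open>f\<close> is a failure exponent per outside vertex, of which there are
      at least \<open>n / 2\<close>. The 3 leaves \<open>2 * k * l\<close> after paying
      \<open>k * l\<close> for the choice of the set.\<close>
    have "\<exists>f\<ge>0. 1 - ?b k \<le> exp (- f) \<and> 3 * real k * l \<le> f * (real n / 2)"
    proof (cases "real k * q 1 < 1")
      case True
      have "1 - ?b k \<le> exp (- ?b k)" using exp_ge_add_one_self[of "- ?b k"] by simp
      moreover have "6 * real k * l \<le> real n * ?b k"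
        unfolding l_def using k True \<open>2 * k \<le> n\<close> by (intro small) auto
      ultimately show ?thesis using b01(1)[of k] by (intro exI[of _ "?b k"]) (simp add: mult.commute)
    next
      case False
      define y where "y = real k * q 1"
      have y: "1 \<le> y" using False by (simp add: y_def)
      have "3 * real k * l \<le> 4 * real k * l" using l by simp
      also have "\<dots> = 2 ^ (2 * r + 4) * (real k * l) / 2 ^ (2 * r + 2)"
        by (simp add: power_add[of 2 "2 * r"])
      also have "\<dots> \<le> C * (real k * l) / 2 ^ (2 * r + 2)"
        using C l by (intro divide_right_mono mult_right_mono) auto
      also have "C * (real k * l) = real k * (C * l)" by simp
      also have "real k * (C * l) / 2 ^ (2 * r + 2) \<le> real k * (real n * q 1) / 2 ^ (2 * r + 2)"
        using C(2) by (intro divide_right_mono mult_left_mono) (simp_all add: l_def)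
      also have "\<dots> = y / 2 ^ (2 * r + 1) * (real n / 2)"
        by (simp add: y_def power_add[of 2 "2 * r"])
      finally have 1: "3 * real k * l \<le> y / 2 ^ (2 * r + 1) * (real n / 2)" .
      have "1 - ?b k \<le> exp (- (y / 2 ^ (2 * r + 1)))"
      \<comment> \<open>For large \<open>y\<close> half of the exponent in
        \<open>r * exp (- y)\<close> absorbs the factor \<open>r\<close>. Otherwise
        \<open>y / 2 < r < 2^r\<close>, so the claimed exponent is at most \<open>2^(- r)\<close>,
        and \<open>?b k\<close> is at least that because \<open>y >= 1\<close> makes each of its
        factors at least 1/2.\<close>
      proof (cases "real r * exp (- (y / 2)) \<le> 1")
        case True
        have "exp (- y) = exp (- (y / 2)) * exp (- (y / 2))" by (simp add: exp_add[symmetric])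
        then have "1 - ?b k \<le> real r * exp (- (y / 2)) * exp (- (y / 2))"
          using bern[of k] by (simp add: y_def mult.assoc)
        also have "\<dots> \<le> 1 * exp (- (y / 2))" using True by (intro mult_right_mono) auto
        also have "\<dots> \<le> exp (- (y / 2 ^ (2 * r + 1)))"
        proof -
          have "(2::real) ^ 1 \<le> 2 ^ (2 * r + 1)" by (intro power_increasing) auto
          then have "y / 2 ^ (2 * r + 1) \<le> y / 2" using y by (intro divide_left_mono) auto
          then show ?thesis by simp
        qed
        finally show ?thesis .
      next
        case False
        then have "exp (y / 2) < real r" by (simp add: exp_minus divide_inverse[symmetric] less_divide_eq)
        then have "y / 2 < real r" using exp_ge_add_one_self[of "y / 2"] by linarith
        moreover have "real r < 2 ^ r" by (rule of_nat_less_two_power)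
        ultimately have "y < 2 ^ (r + 1)" unfolding power_add power_one_right by linarith
        then have "y / 2 ^ (2 * r + 1) \<le> 2 ^ (r + 1) / 2 ^ (2 * r + 1)"
          by (intro divide_right_mono) auto
        also have "\<dots> = 2 ^ (r + 1) / (2 ^ (r + 1) * 2 ^ r)"
        proof -
          have "2 * r + 1 = (r + 1) + r" by simp
          then show ?thesis by (simp only: power_add[of _ "r + 1" r])
        qed
        also have "\<dots> = (1 / 2) ^ r" by (simp add: power_one_over)
        also have "\<dots> \<le> (1 - exp (- y)) ^ r"
        proof (intro power_mono)
          have "exp (- y) \<le> exp (- 1)" using y by simp
          also have "\<dots> \<le> 1 / 2" using exp_ge_add_one_self[of 1] by (simp add: exp_minus field_simps)
          finally show "1 / 2 \<le> 1 - exp (- y)" by simp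
        qed simp
        also have "\<dots> \<le> ?b k" using bge[of k] by (simp add: y_def)
        finally have "y / 2 ^ (2 * r + 1) \<le> ?b k" .
        then have "exp (- ?b k) \<le> exp (- (y / 2 ^ (2 * r + 1)))"
          unfolding exp_le_cancel_iff neg_le_iff_le .
        moreover have "1 - ?b k \<le> exp (- ?b k)" using exp_ge_add_one_self[of "- ?b k"] by simp
        ultimately show ?thesis by (rule order.trans[rotated])
      qed
      moreover have "0 \<le> y / 2 ^ (2 * r + 1)" using y by simp
      ultimately show ?thesis using 1 by (intro exI[of _ "y / 2 ^ (2 * r + 1)"] conjI)
    qed
    then obtain f where f: "f \<ge> 0" "1 - ?b k \<le> exp (- f)" "3 * real k * l \<le> f * (real n / 2)"
      by (elim exE conjE)
    have "(1 - ?b k) ^ (n - k) \<le> exp (- f) ^ (n - k)" using f b01 by (intro power_mono) auto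
    also have "\<dots> = exp (- (f * real (n - k)))" by (simp add: exp_of_nat_mult[symmetric] mult.commute)
    also have "\<dots> \<le> exp (- (f * (real n / 2)))"
    proof -
      have "real n / 2 \<le> real (n - k)" using True by simp
      then show ?thesis using mult_left_mono[of "real n / 2" "real (n - k)" f] f by simp
    qed
    also have "\<dots> \<le> exp (- (3 * real k * l))" using f by simp
    finally have *: "(1 - ?b k) ^ (n - k) \<le> exp (- (3 * real k * l))" .
    have "real (n choose k) \<le> real (n ^ k)" using binomial_le_pow[of k n] k of_nat_le_iff by auto
    also have "\<dots> = exp (real k * l)" using powl by simp
    finally have "real (n choose k) * (1 - ?b k) ^ (n - k) \<le> exp (real k * l) * exp (- (3 * real k * l))"
      using * b01 by (intro mult_mono) auto
    also have "\<dots> = exp (- 2 * (real k * l))" by (simp add: exp_add[symmetric])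
    also have "\<dots> \<le> exp (- 2 * l)" using k1 l by simp
    finally show ?thesis .
  next
    case False
    \<comment> \<open>For sets larger than half, both the number of sets and the number of tests are
      governed by the complement.\<close>
    define m where "m = n - k"
    have m: "1 \<le> m" "m \<le> n" "n - m = k" using k by (auto simp: m_def)
    have "1 - ?b k \<le> real r * exp (- (real k * q 1))" by (rule bern)
    also have "\<dots> \<le> real n * exp (- (4 * l))"
    proof (intro mult_mono)
      have "(8::real) \<le> C"
      proof -
        have "(2::real) ^ 3 \<le> 2 ^ (2 * r + 4)" by (intro power_increasing) auto
        then show ?thesis using C by simp
      qed
      then have "8 * l \<le> C * l" using l by (intro mult_right_mono) auto
      also have "\<dots> \<le> real n * q 1" using C by (simp add: l_def)
      also have "\<dots> \<le> (2 * real k) * q 1" using False q1 by (intro mult_right_mono) auto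
      finally show "exp (- (real k * q 1)) \<le> exp (- (4 * l))" by simp
    qed (use n in auto)
    also have "\<dots> = exp (- 3 * l)" by (subst l(2)[symmetric], subst exp_add[symmetric]) simp
    finally have "(1 - ?b k) ^ m \<le> exp (- 3 * l) ^ m" using b01 by (intro power_mono) auto
    also have "\<dots> = exp (- (3 * real m * l))" by (simp add: exp_of_nat_mult[symmetric] mult_ac)
    finally have *: "(1 - ?b k) ^ m \<le> exp (- (3 * real m * l))" .
    have "real (n choose k) = real (n choose m)" using m by (metis binomial_symmetric)
    also have "\<dots> \<le> real (n ^ m)" using binomial_le_pow[of m n] m of_nat_le_iff by blast
    also have "\<dots> = exp (real m * l)" using powl by simp
    finally have "real (n choose k) * (1 - ?b k) ^ m \<le> exp (real m * l) * exp (- (3 * real m * l))"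
      using * b01 by (intro mult_mono) auto
    also have "\<dots> = exp (- 2 * (real m * l))" by (simp add: exp_add[symmetric])
    also have "\<dots> \<le> exp (- 2 * l)" using m l by simp
    finally show ?thesis by (simp add: m_def)
  qed
  have "measure_pmf.prob (indicator_pmf n r q)
      {w. \<exists>S. k\<^sub>0 \<le> card S \<and> stuck {1..n} r (edges_of w) S}
    \<le> (\<Sum>k\<in>{k\<^sub>0..<n}. real (n choose k) * (1 - ?b k) ^ (n - k))"
    using q by (rule prob_stuck_le)
  also have "\<dots> \<le> (\<Sum>k\<in>{k\<^sub>0..<n}. exp (- 2 * l))" using term_le by (intro sum_mono) auto
  also have "\<dots> \<le> real n * exp (- 2 * l)" by simp
  also have "\<dots> = exp (- l)" by (subst l(2)[symmetric], subst exp_add[symmetric]) simp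
  also have "\<dots> = 1 / real n" using l by (simp add: exp_minus field_simps)
  finally show ?thesis .
qed

section \<open>Success probability of the exploration\<close>

lemma one_minus_exp_ge_half_min:
  fixes y :: real
  assumes "0 \<le> y"
  shows "min 1 y / 2 \<le> 1 - exp (- y)"
proof -
  have "1 + y \<le> exp y" by (rule exp_ge_add_one_self)
  then have "exp (- y) \<le> 1 / (1 + y)" using assms by (simp add: exp_minus field_simps)
  moreover have "min 1 y / 2 \<le> 1 - 1 / (1 + y)"
  proof -
    have "1 - 1 / (1 + y) = y / (1 + y)" using assms by (simp add: field_simps)
    moreover have "min 1 y / 2 \<le> y / (1 + y)"
    proof (cases "y \<le> 1")
      case True
      then have "y / 2 \<le> y / (1 + y)" using assms by (intro divide_left_mono) auto
      then show ?thesis using True by simp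
    next
      case False
      then show ?thesis by (simp add: field_simps)
    qed
    ultimately show ?thesis by simp
  qed
  ultimately show ?thesis by linarith
qed

lemma one_minus_power_ge_half_min:
  fixes p :: real
  assumes "0 \<le> p" "p \<le> 1"
  shows "min 1 (real k * p) / 2 \<le> 1 - (1 - p) ^ k"
  using one_minus_exp_ge_half_min[of "real k * p"] one_minus_power_le_exp[OF assms, of k] assms by simp

text \<open>By monotonicity the colours with \<open>k * q s < 1\<close> form an initial segment, and
  the minimum is 1 beyond it. This is how the partial products \<open>P\<^sub>i\<close> of the
  theorem enter; \<open>i = 1\<close> covers the case in which all factors from colour 2 on are
  1.\<close>

lemma prod_min_initial_segment:
  fixes q :: "nat \<Rightarrow> real"
  assumes j: "1 \<le> j" and q: "\<And>s. s \<in> {1..j} \<Longrightarrow> 0 \<le> q s" and mono: "mono_on {1..j} q"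
  shows "\<exists>i\<in>{1..j}. q 1 * (\<Prod>s\<in>{2..j}. min 1 (real k * q s)) = real k ^ (i - 1) * (\<Prod>s\<in>{1..i}. q s)"
  using assms
proof (induction j rule: nat_induct_at_least)
  case base
  show ?case by (intro bexI[of _ 1]) auto
next
  case (Suc j)
  have j: "1 \<le> j" using Suc.hyps by simp
  have split: "(\<Prod>s\<in>{2..Suc j}. f s) = (\<Prod>s\<in>{2..j}. f s) * f (Suc j)" for f :: "nat \<Rightarrow> real"
    using j by (simp add: prod.cl_ivl_Suc mult.commute)
  show ?case
  proof (cases "1 \<le> real k * q (Suc j)")
    case True
    have "mono_on {1..j} q" using Suc.prems(2) by (rule mono_on_subset) auto
    then obtain i where "i \<in> {1..j}"
      "q 1 * (\<Prod>s\<in>{2..j}. min 1 (real k * q s)) = real k ^ (i - 1) * (\<Prod>s\<in>{1..i}. q s)"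
      using Suc.IH Suc.prems(1) by auto
    then show ?thesis using True unfolding split by (intro bexI[of _ i]) auto
  next
    case False
    have le: "real k * q s < 1" if "s \<in> {1..Suc j}" for s
    proof -
      have "q s \<le> q (Suc j)" using Suc.prems(2) that by (auto simp: mono_on_def)
      then have "real k * q s \<le> real k * q (Suc j)" by (intro mult_left_mono) auto
      then show ?thesis using False by linarith
    qed
    have "(\<Prod>s\<in>{2..Suc j}. min 1 (real k * q s)) = (\<Prod>s\<in>{2..Suc j}. real k * q s)"
      by (intro prod.cong refl min_absorb2 less_imp_le le) auto
    also have "\<dots> = real k ^ j * (\<Prod>s\<in>{2..Suc j}. q s)" by (simp add: prod.distrib)
    finally have "q 1 * (\<Prod>s\<in>{2..Suc j}. min 1 (real k * q s)) = real k ^ j * (q 1 * (\<Prod>s\<in>{2..Suc j}. q s))"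
      by simp
    also have "q 1 * (\<Prod>s\<in>{2..Suc j}. q s) = (\<Prod>s\<in>{1..Suc j}. q s)"
      by (subst prod.atLeast_Suc_atMost[of 1]) (auto simp: numeral_2_eq_2)
    finally show ?thesis by (intro bexI[of _ "Suc j"]) auto
  qed
qed

text \<open>\<open>n * growth q r k\<close> is, up to a factor \<open>2 ^ r\<close>, the expected number of vertices by which a cluster
  of size \<open>k\<close> can be extended through a given one of its vertices in colour 1.\<close>

definition growth :: "(nat \<Rightarrow> real) \<Rightarrow> nat \<Rightarrow> nat \<Rightarrow> real" where
  "growth q r k = q 1 * (\<Prod>s\<in>{2..r}. min 1 (real k * q s))"

text \<open>With \<open>i\<close> from the initial segment, the hypotheses give
  \<open>C * (k / l)^(i-1)\<close> for \<open>i >= 2\<close> and \<open>C * l\<close> for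
  \<open>i = 1\<close>. Below \<open>l\<close> the worst case is \<open>i = r\<close>; above
  \<open>l\<close> it is \<open>i = 2\<close> or \<open>i = 1\<close>, whence the minimum.\<close>

lemma growth_lower_bound:
  fixes q :: "nat \<Rightarrow> real" and C l :: real
  assumes r: "1 \<le> r" and q: "\<And>s. s \<in> {1..r} \<Longrightarrow> 0 \<le> q s" and mono: "mono_on {1..r} q"
    and n: "0 < n" and l: "1 \<le> l" and C: "0 \<le> C"
    and P1: "C * l / real n \<le> q 1"
    and P: "\<And>i. i \<in> {2..r} \<Longrightarrow> C / (real n * l ^ (i - 1)) \<le> (\<Prod>j\<in>{1..i}. q j)"
  shows "real k \<le> l \<Longrightarrow> C * (real k / l) ^ (r - 1) \<le> real n * growth q r k"
    and "l \<le> real k \<Longrightarrow> C * min (real k / l) l \<le> real n * growth q r k"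
proof -
  obtain i where i: "i \<in> {1..r}" "growth q r k = real k ^ (i - 1) * (\<Prod>s\<in>{1..i}. q s)"
    unfolding growth_def using prod_min_initial_segment[OF r q mono, of k] by blast
  have g1: "C * l \<le> real n * growth q r k" if "i = 1"
    using P1 n i that by (simp add: field_simps)
  have g2: "C * (real k / l) ^ (i - 1) \<le> real n * growth q r k" if "i \<noteq> 1"
  proof -
    have "C / (real n * l ^ (i - 1)) \<le> (\<Prod>j\<in>{1..i}. q j)" using i that by (intro P) auto
    then have "real k ^ (i - 1) * (C / (real n * l ^ (i - 1))) \<le> growth q r k"
      unfolding i(2) by (intro mult_left_mono) auto
    then have "real n * (real k ^ (i - 1) * (C / (real n * l ^ (i - 1)))) \<le> real n * growth q r k"
      by (intro mult_left_mono) auto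
    then show ?thesis using n by (simp add: power_divide mult_ac)
  qed
  show "C * (real k / l) ^ (r - 1) \<le> real n * growth q r k" if k: "real k \<le> l"
  proof (cases "i = 1")
    case True
    have "(real k / l) ^ (r - 1) \<le> 1" using k l by (intro power_le_one) auto
    then have "C * (real k / l) ^ (r - 1) \<le> C * l" using l C by (intro mult_left_mono) auto
    then show ?thesis using g1[OF True] by linarith
  next
    case False
    have "(real k / l) ^ (r - 1) \<le> (real k / l) ^ (i - 1)"
      using k l i by (intro power_decreasing) auto
    then have "C * (real k / l) ^ (r - 1) \<le> C * (real k / l) ^ (i - 1)" using C by (rule mult_left_mono)
    then show ?thesis using g2[OF False] by linarith
  qed
  show "C * min (real k / l) l \<le> real n * growth q r k" if k: "l \<le> real k"
  proof (cases "i = 1")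
    case True
    have "C * min (real k / l) l \<le> C * l" using C by (intro mult_left_mono) auto
    then show ?thesis using g1[OF True] by linarith
  next
    case False
    have "(real k / l) ^ 1 \<le> (real k / l) ^ (i - 1)"
      using k l i False by (intro power_increasing) auto
    then have "C * min (real k / l) l \<le> C * (real k / l) ^ (i - 1)" using C by (intro mult_left_mono) auto
    then show ?thesis using g2[OF False] by linarith
  qed
qed

lemma prod_half_min:
  fixes q :: "nat \<Rightarrow> real"
  assumes "\<And>s. s \<in> S \<Longrightarrow> 0 \<le> q s \<and> q s \<le> 1"
  shows "(\<Prod>s\<in>S. min 1 (real k * q s)) / 2 ^ card S \<le> (\<Prod>s\<in>S. 1 - (1 - q s) ^ k)"
proof -
  have "(\<Prod>s\<in>S. min 1 (real k * q s)) / 2 ^ card S = (\<Prod>s\<in>S. min 1 (real k * q s) / 2)"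
    by (simp add: prod_dividef)
  also have "\<dots> \<le> (\<Prod>s\<in>S. 1 - (1 - q s) ^ k)"
    using assms one_minus_power_ge_half_min by (intro prod_mono) auto
  finally show ?thesis .
qed

text \<open>Replaces the cost \<open>ln (1 + t)\<close> of an unlikely extension by a square root,
  which is summable over cluster sizes up to \<open>l\<close> with total
  \<open>O(l)\<close>.\<close>

lemma one_plus_le_exp_sqrt:
  fixes t :: real
  assumes "0 \<le> t"
  shows "1 + t \<le> exp (sqrt t)"
proof -
  define x where "x = sqrt t"
  have x: "0 \<le> x" "t = x ^ 2" using assms by (simp_all add: x_def)
  \<comment> \<open>The Taylor polynomial is taken at \<open>x / 2\<close> and squared, because
    \<open>1 + x + x^2 / 2\<close> itself drops below \<open>1 + x^2\<close> for
    \<open>x > 2\<close>.\<close>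
  have "(1 + x / 2 + (x / 2) ^ 2 / 2) ^ 2 - (1 + x ^ 2) = x * ((1 - x / 4) ^ 2 + (x / 4) ^ 2) + x ^ 4 / 64"
    by (simp add: power2_eq_square power4_eq_xxxx algebra_simps)
  moreover have "0 \<le> x * ((1 - x / 4) ^ 2 + (x / 4) ^ 2) + x ^ 4 / 64" using x by simp
  ultimately have "1 + x ^ 2 \<le> (1 + x / 2 + (x / 2) ^ 2 / 2) ^ 2" by linarith
  also have "\<dots> \<le> exp (x / 2) ^ 2"
    using x by (intro power_mono exp_lower_Taylor_quadratic) auto
  also have "\<dots> = exp x" by (simp add: exp_double[symmetric])
  finally show ?thesis unfolding x(2)[symmetric] by (simp add: x_def)
qed

text \<open>Telescoping via \<open>1 / sqrt N <= 2 * (sqrt N - sqrt (N - 1))\<close>. The minimum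
  lets the induction continue past \<open>l\<close>, where the terms are zero.\<close>

lemma sum_inverse_sqrt_le:
  fixes l :: real
  assumes "0 \<le> l"
  shows "(\<Sum>j\<in>{1..<N}. if real j \<le> l then 1 / sqrt (real j) else 0) \<le> 2 * sqrt (min (real (N - 1)) l)"
proof (induction N)
  case 0
  then show ?case using assms by simp
next
  case (Suc N)
  show ?case
  proof (cases "N = 0")
    case True
    then show ?thesis using assms by simp
  next
    case False
    let ?f = "\<lambda>j. if real j \<le> l then 1 / sqrt (real j) else 0"
    have "(\<Sum>j\<in>{1..<Suc N}. ?f j) = (\<Sum>j\<in>{1..<N}. ?f j) + ?f N"
      using False by (simp add: sum.atLeastLessThan_Suc)
    also have "\<dots> \<le> 2 * sqrt (min (real N) l)"
    proof (cases "real N \<le> l")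
      case True
      let ?a = "sqrt (real (N - 1))" and ?b = "sqrt (real N)"
      have ab: "0 \<le> ?a" "0 < ?b" "?a \<le> ?b" using False by auto
      have "(?b - ?a) * (?b + ?a) = real N - real (N - 1)" by (simp add: algebra_simps)
      then have "1 = (?b - ?a) * (?b + ?a)" using False by simp
      also have "\<dots> \<le> (?b - ?a) * (2 * ?b)" using ab by (intro mult_left_mono) auto
      finally have "1 / ?b \<le> 2 * (?b - ?a)" using ab by (simp add: field_simps)
      moreover have "(\<Sum>j\<in>{1..<N}. ?f j) \<le> 2 * ?a"
        using Suc.IH True False by (simp add: min_def split: if_splits)
      ultimately show ?thesis using True by (simp add: min_def)
    next
      case False
      have "sqrt (min (real (N - 1)) l) \<le> sqrt (min (real N) l)"
        by (intro real_sqrt_le_mono min.mono) auto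
      moreover have "?f N = 0" using False by simp
      ultimately show ?thesis using Suc.IH by linarith
    qed
    finally show ?thesis by simp
  qed
qed

lemma sum_inverse_square_le:
  fixes l :: real
  assumes "1 \<le> l"
  shows "(\<Sum>j\<in>{1..<N}. if real j \<le> l then 0 else l / real j ^ 2) \<le> 2"
proof -
  let ?f = "\<lambda>j. if real j \<le> l then 0 else l / real j ^ 2"
  \<comment> \<open>The strengthening by \<open>- l / N\<close> makes the sum telescope through
    \<open>1 / a - 1 / (a + 1)\<close>; the first term beyond \<open>l\<close> starts it, being at
    most 1.\<close>
  have "(\<Sum>j\<in>{1..<Suc N}. ?f j) \<le> (if real N \<le> l then 0 else 2 - l / real N)" for N
  proof (induction N)
    case 0
    then show ?case using assms by simp
  next
    case (Suc N)
    have eq: "(\<Sum>j\<in>{1..<Suc (Suc N)}. ?f j) = (\<Sum>j\<in>{1..<Suc N}. ?f j) + ?f (Suc N)"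
      by (simp add: sum.atLeastLessThan_Suc)
    consider "real (Suc N) \<le> l" | "real N \<le> l" "l < real (Suc N)" | "l < real N" by linarith
    then show ?case
    proof cases
      case 1
      then show ?thesis using Suc.IH eq by simp
    next
      case 2
      have "l / real (Suc N) \<le> 1" using 2 by simp
      moreover have "l / real (Suc N) ^ 2 \<le> 1"
      proof -
        have "l \<le> real (Suc N) * 1" using 2 by simp
        also have "\<dots> \<le> real (Suc N) * real (Suc N)" by (intro mult_left_mono) auto
        finally show ?thesis by (simp add: power2_eq_square)
      qed
      ultimately have "l / real (Suc N) ^ 2 \<le> 2 - l / real (Suc N)" by linarith
      then show ?thesis using Suc.IH eq 2 by simp
    next
      case 3
      have N: "1 < real N" using 3 assms by linarith
      define a where "a = real N"
      have a: "1 < a" "real (Suc N) = a + 1" using N by (simp_all add: a_def)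
      have "1 / (a + 1) ^ 2 \<le> 1 / (a * (a + 1))"
        using a by (intro divide_left_mono) (auto simp: power2_eq_square)
      also have "\<dots> = 1 / a - 1 / (a + 1)" using a by (simp add: field_simps)
      finally have "l * (1 / (a + 1) ^ 2) \<le> l * (1 / a - 1 / (a + 1))"
        using assms by (intro mult_left_mono) auto
      then have "l / (a + 1) ^ 2 \<le> l / a - l / (a + 1)" by (simp add: right_diff_distrib)
      moreover have "(\<Sum>j\<in>{1..<Suc N}. ?f j) \<le> 2 - l / a" using Suc.IH 3 by (simp add: a_def)
      moreover have "?f (Suc N) = l / (a + 1) ^ 2" using 3 unfolding a(2)[symmetric] by simp
      moreover have "\<not> real (Suc N) \<le> l" using 3 by simp
      ultimately show ?thesis unfolding eq a(2) by simp
    qed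
  qed
  from this[of "N - 1"] show ?thesis
    using assms by (cases N) (auto split: if_splits intro: order.trans)
qed

text \<open>Uses \<open>1 - exp (- x) >= 1 / (1 + 1 / x)\<close> and
  \<open>1 + (1 / z)^m <= (1 + 1 / z)^m\<close>. The power in the growth rate thereby costs only a
  factor \<open>m\<close> in the exponent.\<close>

lemma one_minus_exp_ge_small:
  fixes x z :: real
  assumes "1 \<le> m" "0 < z" "z ^ m \<le> x"
  shows "exp (- (real m * sqrt (1 / z))) \<le> 1 - exp (- x)"
proof -
  have x: "0 < x" using assms by (meson less_le_trans zero_less_power)
  have "1 + 1 / x \<le> 1 + (1 / z) ^ m"
    using assms x by (simp add: power_one_over divide_left_mono)
  also have "\<dots> \<le> (1 + 1 / z) ^ m"
    using assms(1)
  proof (induction m rule: nat_induct_at_least)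
    case base
    then show ?case by simp
  next
    case (Suc m)
    have "1 + (1 / z) ^ Suc m \<le> (1 + (1 / z) ^ m) * (1 + 1 / z)"
      using assms(2) by (simp add: algebra_simps)
    also have "\<dots> \<le> (1 + 1 / z) ^ m * (1 + 1 / z)"
      using Suc.IH assms(2) by (intro mult_right_mono) auto
    finally show ?case by (simp add: mult.commute)
  qed
  also have "\<dots> \<le> exp (sqrt (1 / z)) ^ m"
    using assms by (intro power_mono one_plus_le_exp_sqrt) auto
  also have "\<dots> = exp (real m * sqrt (1 / z))" by (simp add: exp_of_nat_mult)
  finally have 1: "1 + 1 / x \<le> exp (real m * sqrt (1 / z))" .
  have "exp (- (real m * sqrt (1 / z))) = 1 / exp (real m * sqrt (1 / z))"
    by (simp add: exp_minus field_simps)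
  also have "\<dots> \<le> 1 / (1 + 1 / x)" using 1 x by (intro divide_left_mono) (auto simp: add_pos_pos)
  also have "\<dots> = 1 - 1 / (1 + x)" using x by (simp add: field_simps)
  also have "\<dots> \<le> 1 - exp (- x)"
    using exp_ge_add_one_self[of x] x by (simp add: exp_minus field_simps)
  finally show ?thesis .
qed

text \<open>For large \<open>x\<close> the cost \<open>- ln (1 - exp (- x))\<close> is at most
  \<open>1 / (exp x - 1)\<close>, and a quadratic denominator already makes it summable over sizes
  above \<open>l\<close>.\<close>

lemma one_minus_exp_ge_large:
  fixes x :: real
  assumes "0 < x"
  shows "exp (- (2 / x ^ 2)) \<le> 1 - exp (- x)"
proof -
  have e: "x ^ 2 / 2 \<le> exp x - 1" using exp_lower_Taylor_quadratic[of x] assms by simp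
  have x2: "0 < x ^ 2 / 2" using assms by simp
  define d where "d = exp x - 1"
  have d: "0 < d" "exp x = 1 + d" "x ^ 2 / 2 \<le> d" using e x2 unfolding d_def by linarith+
  have "1 / d \<le> 1 / (x ^ 2 / 2)" by (rule divide_left_mono[OF d(3) _ mult_pos_pos[OF d(1) x2]]) simp
  then have "exp (1 / d) \<le> exp (2 / x ^ 2)" by simp
  moreover have "1 + 1 / d \<le> exp (1 / d)" by (rule exp_ge_add_one_self)
  ultimately have 1: "1 + 1 / d \<le> exp (2 / x ^ 2)" by linarith
  have "exp (- (2 / x ^ 2)) = 1 / exp (2 / x ^ 2)" by (simp add: exp_minus field_simps)
  also have "\<dots> \<le> 1 / (1 + 1 / d)" using 1 d by (intro divide_left_mono) (auto simp: add_pos_pos)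
  also have "\<dots> = 1 - 1 / (1 + d)" using d(1) by (simp add: field_simps)
  also have "\<dots> = 1 - exp (- x)" unfolding d(2)[symmetric] by (simp add: exp_minus field_simps)
  finally show ?thesis .
qed

section \<open>Cost of one trial and the effect of many trials\<close>

lemma C_const_ge: "2 \<le> r \<Longrightarrow> k \<le> 8 * r\<^sup>2 \<Longrightarrow> 2 ^ k \<le> C_const r"
  unfolding C_const_def by (intro power_increasing) auto

lemma C_const_pos: "0 < C_const r"
  unfolding C_const_def by simp

lemma growth_nonneg:
  assumes "1 \<le> r" "\<And>s. s \<in> {1..r} \<Longrightarrow> 0 \<le> q s \<and> q s \<le> 1"
  shows "0 \<le> growth q r k"
  unfolding growth_def using assms by (intro mult_nonneg_nonneg prod_nonneg) auto

text \<open>The costs of all extensions are added in the exponent. Sizes up to \<open>l\<close> cost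
  about \<open>sqrt (l / j)\<close> each and dominate; sizes between \<open>l\<close> and
  \<open>l\<^sup>2\<close> cost about \<open>(l / j)^2\<close> each. Both sums are of order
  \<open>l\<close>, and \<open>C_const r\<close> makes their coefficients small.\<close>

lemma trial_success_bound:
  fixes l :: real and g :: "nat \<Rightarrow> real"
  assumes r: "2 \<le> r" and l: "1 \<le> l" and K: "real K \<le> l ^ 2 + 1"
    and g1: "\<And>k. real k \<le> l \<Longrightarrow> C_const r * (real k / l) ^ (r - 1) \<le> g k"
    and g2: "\<And>k. l \<le> real k \<Longrightarrow> C_const r * min (real k / l) l \<le> g k"
  shows "exp (- (2 * real r * l / 2 ^ (4 * r))) \<le> (\<Prod>j\<in>{1..<K}. 1 - exp (- (g j / 2 ^ (r + 1))))"
proof -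
  let ?x = "\<lambda>j. g j / 2 ^ (r + 1)"
  \<comment> \<open>\<open>A\<close> comes from \<open>(r - 1) * sqrt (1 / z)\<close> with
    \<open>z = 2^(8 * r) * j / l\<close>, and \<open>B\<close> from \<open>2 / x^2\<close> with
    \<open>x\<close> at least \<open>2^(4 * r)\<close> times the minimum of \<open>j / l\<close> and
    \<open>l\<close>.\<close>
  define A where "A = real (r - 1) * sqrt l / 2 ^ (4 * r)"
  define B where "B = (2::real) / 2 ^ (8 * r)"
  let ?f = "\<lambda>j. if real j \<le> l then 1 / sqrt (real j) else 0"
  let ?h = "\<lambda>j. if real j \<le> l then 0 else l / real j ^ 2"
  have rr: "8 * r * 2 \<le> 8 * r\<^sup>2" using r by (simp add: power2_eq_square)
  have each: "exp (- (A * ?f j + B * (l * ?h j + 1 / l ^ 2))) \<le> 1 - exp (- ?x j)" if j: "j \<in> {1..<K}" for j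
  proof (cases "real j \<le> l")
    case True
    define z where "z = 2 ^ (8 * r) * (real j / l)"
    have z: "0 < z" using j l by (simp add: z_def)
    \<comment> \<open>The budget \<open>8 * r\<^sup>2\<close> gives \<open>8 * r\<close> to each of
      the \<open>r - 1\<close> factors \<open>j / l\<close>; the remaining \<open>8 * r\<close>
      covers the denominator \<open>2 ^ (r + 1)\<close>.\<close>
    have e: "8 * r * (r - 1) + (r + 1) \<le> 8 * r\<^sup>2"
    proof -
      obtain m where "r = m + 2" using r by (metis add.commute le_Suc_ex)
      then show ?thesis by (simp add: power2_eq_square algebra_simps)
    qed
    have "z ^ (r - 1) * 2 ^ (r + 1) = 2 ^ (8 * r * (r - 1) + (r + 1)) * (real j / l) ^ (r - 1)"
      unfolding z_def power_mult_distrib power_mult power_add by simp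
    also have "\<dots> \<le> C_const r * (real j / l) ^ (r - 1)"
      using l by (intro mult_right_mono C_const_ge[OF r e] zero_le_power) auto
    also have "\<dots> \<le> g j" using g1[OF True] .
    finally have "z ^ (r - 1) \<le> ?x j" by (simp add: le_divide_eq)
    then have "exp (- (real (r - 1) * sqrt (1 / z))) \<le> 1 - exp (- ?x j)"
      using r z by (intro one_minus_exp_ge_small) auto
    moreover have "real (r - 1) * sqrt (1 / z) = A * ?f j"
    proof -
      have "sqrt (2 ^ (8 * r)) = (2::real) ^ (4 * r)"
        by (rule real_sqrt_unique) (simp_all add: power_mult[symmetric] mult.commute)
      then show ?thesis using True by (simp add: A_def z_def real_sqrt_divide real_sqrt_mult)
    qed
    moreover have "0 \<le> B * (l * ?h j + 1 / l ^ 2)" using l by (simp add: B_def)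
    ultimately show ?thesis by (smt (verit) exp_le_cancel_iff)
  next
    case False
    have e: "4 * r + (r + 1) \<le> 8 * r\<^sup>2" using rr r by linarith
    define m where "m = min (real j / l) l"
    have m: "0 < m" using False l by (auto simp: m_def)
    have "2 ^ (4 * r) * m * 2 ^ (r + 1) = 2 ^ (4 * r + (r + 1)) * m"
      unfolding power_add by simp
    also have "\<dots> \<le> C_const r * m" using m by (intro mult_right_mono C_const_ge[OF r e]) auto
    also have "\<dots> \<le> g j" unfolding m_def using False by (intro g2) simp
    finally have x: "2 ^ (4 * r) * m \<le> ?x j" by (simp add: le_divide_eq)
    have x0: "0 < 2 ^ (4 * r) * m" using m by simp
    have xp: "0 < ?x j" using x x0 by linarith
    have "2 / (?x j) ^ 2 \<le> 2 / (2 ^ (4 * r) * m) ^ 2"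
      by (rule divide_left_mono[OF power_mono[OF x less_imp_le[OF x0]] _
            mult_pos_pos[OF zero_less_power[OF xp] zero_less_power[OF x0]]]) simp
    also have "\<dots> = B * (1 / m ^ 2)"
      by (simp add: B_def power_mult_distrib power_mult[symmetric] mult.commute)
    also have "1 / m ^ 2 \<le> l * ?h j + 1 / l ^ 2"
    proof (cases "real j / l \<le> l")
      case True
      then have "1 / m ^ 2 = l * ?h j"
        using False by (simp add: m_def power_divide power2_eq_square)
      then show ?thesis using l by simp
    next
      case F: False
      then have "m = l" by (simp add: m_def)
      then show ?thesis using l by simp
    qed
    finally have "2 / (?x j) ^ 2 \<le> B * (l * ?h j + 1 / l ^ 2)"
      by (simp add: B_def mult_left_mono divide_right_mono)
    then have "exp (- (A * ?f j + B * (l * ?h j + 1 / l ^ 2))) \<le> exp (- (2 / (?x j) ^ 2))"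
      using False by simp
    also have "\<dots> \<le> 1 - exp (- ?x j)"
      using x x0 by (intro one_minus_exp_ge_large) linarith
    finally show ?thesis .
  qed
  have sum: "(\<Sum>j\<in>{1..<K}. A * ?f j + B * (l * ?h j + 1 / l ^ 2)) \<le> 2 * real r * l / 2 ^ (4 * r)"
  proof -
    have A0: "0 \<le> A" and B0: "0 \<le> B" using l by (auto simp: A_def B_def)
    have "(\<Sum>j\<in>{1..<K}. A * ?f j + B * (l * ?h j + 1 / l ^ 2))
      = A * (\<Sum>j\<in>{1..<K}. ?f j) + B * (l * (\<Sum>j\<in>{1..<K}. ?h j) + real (K - 1) / l ^ 2)"
      by (simp only: sum.distrib sum_distrib_left[symmetric] distrib_left) simp
    also have "\<dots> \<le> A * (2 * sqrt l) + B * (l * 2 + 1)"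
    proof (intro add_mono mult_left_mono A0 B0)
      have "(\<Sum>j\<in>{1..<K}. ?f j) \<le> 2 * sqrt (min (real (K - 1)) l)"
        using l by (intro sum_inverse_sqrt_le) simp
      also have "\<dots> \<le> 2 * sqrt l" by simp
      finally show "(\<Sum>j\<in>{1..<K}. ?f j) \<le> 2 * sqrt l" .
      show "(\<Sum>j\<in>{1..<K}. ?h j) \<le> 2" using l by (rule sum_inverse_square_le)
      have "real (K - 1) \<le> l ^ 2" using K by (cases K) auto
      then show "real (K - 1) / l ^ 2 \<le> 1" using l by simp
    qed (use l in auto)
    also have "A * (2 * sqrt l) = 2 * real (r - 1) * l / 2 ^ (4 * r)"
      using l by (simp add: A_def mult.assoc[symmetric])
    also have "B * (l * 2 + 1) \<le> 2 * l / 2 ^ (4 * r)"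
    proof -
      have "(2::real) ^ 2 \<le> 2 ^ (4 * r)" using r by (intro power_increasing) auto
      then have "4 / 2 ^ (4 * r) \<le> (1::real)" by simp
      then have "4 * l / 2 ^ (4 * r) \<le> l" using l mult_right_mono[of "4 / 2 ^ (4 * r)" 1 l] by simp
      have "B * (l * 2 + 1) \<le> B * (4 * l)" using l B0 by (intro mult_left_mono) auto
      also have "\<dots> = 2 * (4 * l / 2 ^ (4 * r)) / 2 ^ (4 * r)"
      proof -
        have "8 * r = 4 * r + 4 * r" by simp
        then show ?thesis unfolding B_def by (simp only: power_add) simp
      qed
      also have "\<dots> \<le> 2 * l / 2 ^ (4 * r)"
        using \<open>4 * l / 2 ^ (4 * r) \<le> l\<close> by (intro divide_right_mono mult_left_mono) auto
      finally show ?thesis .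
    qed
    also have "2 * real (r - 1) * l / 2 ^ (4 * r) + 2 * l / 2 ^ (4 * r) = 2 * real r * l / 2 ^ (4 * r)"
      using r by (simp add: of_nat_diff add_divide_distrib[symmetric] algebra_simps)
    finally show ?thesis by simp
  qed
  have "exp (- (2 * real r * l / 2 ^ (4 * r)))
    \<le> exp (- (\<Sum>j\<in>{1..<K}. A * ?f j + B * (l * ?h j + 1 / l ^ 2)))"
    using sum by simp
  also have "\<dots> = (\<Prod>j\<in>{1..<K}. exp (- (A * ?f j + B * (l * ?h j + 1 / l ^ 2))))"
    by (simp only: exp_sum[symmetric] sum_negf finite_atLeastLessThan)
  also have "\<dots> \<le> (\<Prod>j\<in>{1..<K}. 1 - exp (- ?x j))"
    using each by (intro prod_mono) auto
  finally show ?thesis .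
qed

text \<open>The history is bounded by \<open>H = T * K\<close>. The two assumptions on it keep half
  of the vertices unexplored and make \<open>(1 - q 1) ^ H\<close> at least 1/2.\<close>

lemma growth_phase:
  fixes q :: "nat \<Rightarrow> real" and l :: real
  assumes r: "2 \<le> r" and q: "\<And>s. s \<in> {1..r} \<Longrightarrow> 0 \<le> q s \<and> q s \<le> 1"
    and mono: "mono_on {1..r} q" and n: "0 < n" and l: "1 \<le> l"
    and P1: "C_const r * l / real n \<le> q 1"
    and P: "\<And>i. i \<in> {2..r} \<Longrightarrow> C_const r / (real n * l ^ (i - 1)) \<le> (\<Prod>j\<in>{1..i}. q j)"
    and K: "1 \<le> K" "real K \<le> l ^ 2 + 1" and T: "1 \<le> T"
    and H: "2 * (T * K) \<le> n" "real (T * K) * q 1 \<le> 1 / 2"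
  shows "measure_pmf.prob (indicator_pmf n r q)
      {w. \<not> (\<exists>S\<subseteq>{1..n}. spanned r (edges_of w) S \<and> card S = K)}
    \<le> exp (- (real T * exp (- (2 * real r * l / 2 ^ (4 * r)))))"
proof -
  define g where "g = (\<lambda>k. real n * growth q r k)"
  \<comment> \<open>One factor 2 in \<open>2 ^ r\<close> pays for the forbidden colour 1 neighbours,
    the other \<open>r - 1\<close> for replacing each colour's probability by
    \<open>min 1 (k * q s) / 2\<close>.\<close>
  define a where "a = (\<lambda>k. growth q r k / 2 ^ r)"
  \<comment> \<open>At least \<open>n / 2\<close> candidates with success probability
    \<open>a k\<close> each; this halving is the additional 2 in \<open>2 ^ (r + 1)\<close>.\<close>
  define s where "s = (\<lambda>k. 1 - exp (- (g k / 2 ^ (r + 1))))"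
  have r1: "1 \<le> r" using r by simp
  have q1: "0 \<le> q 1" "q 1 \<le> 1" using q[of 1] r by auto
  have g0: "0 \<le> growth q r k" for k using r1 q by (rule growth_nonneg)
  have a0: "0 \<le> a k" for k using g0 by (simp add: a_def)
  have a_le: "a k \<le> q 1 * (1 - q 1) ^ (T * K) * (\<Prod>s\<in>{2..r}. 1 - (1 - q s) ^ k)" for k
  proof -
    have "1 / 2 \<le> 1 + real (T * K) * (- q 1)" using H(2) by simp
    also have "\<dots> \<le> (1 + (- q 1)) ^ (T * K)" using q1 by (intro Bernoulli_inequality) simp
    finally have half: "1 / 2 \<le> (1 - q 1) ^ (T * K)" by simp
    have "a k = q 1 * (1 / 2) * ((\<Prod>s\<in>{2..r}. min 1 (real k * q s)) / 2 ^ card {2..r})"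
      using r by (cases r) (simp_all add: a_def growth_def)
    also have "\<dots> \<le> q 1 * (1 - q 1) ^ (T * K) * (\<Prod>s\<in>{2..r}. 1 - (1 - q s) ^ k)"
      using q q1 half
      by (intro mult_mono mult_left_mono prod_half_min divide_nonneg_pos prod_nonneg) auto
    finally show ?thesis .
  qed
  have a1: "a k \<le> 1" for k
  proof -
    have "(\<Prod>s\<in>{2..r}. min 1 (real k * q s)) \<le> 1"
      using q by (intro prod_le_1) auto
    then have "growth q r k \<le> 1" unfolding growth_def
      using q q1 by (intro mult_le_one prod_nonneg) auto
    also have "1 \<le> (2::real) ^ r" by simp
    finally show ?thesis by (simp add: a_def)
  qed
  have s_ok: "0 \<le> s k \<and> s k \<le> 1 \<and> (1 - a k) ^ (n - T * K) \<le> 1 - s k" for k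
  proof -
    have "(1 - a k) ^ (n - T * K) \<le> exp (- (real (n - T * K) * a k))"
      using a0 a1 by (rule one_minus_power_le_exp)
    also have "\<dots> \<le> exp (- (real n / 2 * a k))"
    proof -
      have "real n \<le> real (2 * (n - T * K))" using H(1) unfolding of_nat_le_iff by simp
      then have "real n / 2 \<le> real (n - T * K)" by simp
      then have "real n / 2 * a k \<le> real (n - T * K) * a k" using a0 by (rule mult_right_mono)
      then show ?thesis by simp
    qed
    also have "real n / 2 * a k = g k / 2 ^ (r + 1)" by (simp add: a_def g_def)
    finally show ?thesis using g0[of k] by (simp add: s_def g_def)
  qed
  define Q where "Q = (\<Prod>j\<in>{1..<K}. s j)"
  have Q: "exp (- (2 * real r * l / 2 ^ (4 * r))) \<le> Q"
    unfolding Q_def s_def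
  proof (rule trial_success_bound[OF r l K(2)])
    show "C_const r * (real k / l) ^ (r - 1) \<le> g k" if "real k \<le> l" for k
      unfolding g_def using q C_const_pos[of r] that
      by (intro growth_lower_bound(1)[OF r1 _ mono n l _ P1 P]) auto
    show "C_const r * min (real k / l) l \<le> g k" if "l \<le> real k" for k
      unfolding g_def using q C_const_pos[of r] that
      by (intro growth_lower_bound(2)[OF r1 _ mono n l _ P1 P]) auto
  qed
  have Q01: "0 \<le> Q" "Q \<le> 1" unfolding Q_def using s_ok by (auto intro!: prod_nonneg prod_le_1)
  have "measure_pmf.prob (indicator_pmf n r q)
      {w. \<not> (\<exists>S\<subseteq>{1..n}. spanned r (edges_of w) S \<and> card S = K)} \<le> (1 - Q) ^ T"
    unfolding Q_def
    using a0 a_le s_ok H(1) K(1) T by (intro exploration_start[where a = a and H = "T * K", OF r1 q]) auto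
  also have "\<dots> \<le> exp (- (real T * Q))" using Q01 by (rule one_minus_power_le_exp)
  also have "\<dots> \<le> exp (- (real T * exp (- (2 * real r * l / 2 ^ (4 * r)))))"
    using Q by (simp add: mult_left_mono)
  finally show ?thesis .
qed

section \<open>The supercritical regime\<close>

lemma not_percolates_cases:
  assumes "\<not> percolates {1..n} r E"
  shows "\<not> (\<exists>S\<subseteq>{1..n}. spanned r E S \<and> card S = K) \<or> (\<exists>S. K \<le> card S \<and> stuck {1..n} r E S)"
proof (rule disjCI)
  assume *: "\<not> (\<exists>S. K \<le> card S \<and> stuck {1..n} r E S)"
  show "\<not> (\<exists>S\<subseteq>{1..n}. spanned r E S \<and> card S = K)"
  proof
    assume "\<exists>S\<subseteq>{1..n}. spanned r E S \<and> card S = K"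
    then obtain S where S: "S \<subseteq> {1..n}" "spanned r E S" "card S = K" by blast
    have "\<not> stuck {1..n} r E C" if "S \<subseteq> C" for C
    proof
      assume C: "stuck {1..n} r E C"
      then have "finite C" by (auto simp: stuck_def intro: finite_subset)
      then have "K \<le> card C" using that S(3) card_mono by blast
      then show False using * C by blast
    qed
    then have "percolates {1..n} r E" using S by (intro percolates_if_not_stuck) auto
    then show False using assms by simp
  qed
qed

lemma prob_not_percolates_le:
  "measure_pmf.prob (indicator_pmf n r q) {w. \<not> percolates {1..n} r (edges_of w)}
    \<le> measure_pmf.prob (indicator_pmf n r q)
        {w. \<not> (\<exists>S\<subseteq>{1..n}. spanned r (edges_of w) S \<and> card S = K)}
      + measure_pmf.prob (indicator_pmf n r q)
        {w. \<exists>S. K \<le> card S \<and> stuck {1..n} r (edges_of w) S}"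
proof -
  have "measure_pmf.prob (indicator_pmf n r q) {w. \<not> percolates {1..n} r (edges_of w)}
    \<le> measure_pmf.prob (indicator_pmf n r q)
      ({w. \<not> (\<exists>S\<subseteq>{1..n}. spanned r (edges_of w) S \<and> card S = K)}
        \<union> {w. \<exists>S. K \<le> card S \<and> stuck {1..n} r (edges_of w) S})"
    using not_percolates_cases[of n r _ K] by (intro measure_pmf.finite_measure_mono) auto
  also have "\<dots> \<le> measure_pmf.prob (indicator_pmf n r q)
        {w. \<not> (\<exists>S\<subseteq>{1..n}. spanned r (edges_of w) S \<and> card S = K)}
      + measure_pmf.prob (indicator_pmf n r q)
        {w. \<exists>S. K \<le> card S \<and> stuck {1..n} r (edges_of w) S}"
    by (rule measure_Un_le) auto
  finally show ?thesis .
qed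

text \<open>Yields \<open>2 * r / 2^(4 * r) <= 1 / (16 * r)\<close>, so the number of trials, about
  \<open>n^(1 / (8 * r))\<close>, outweighs the failure of a single one.\<close>

lemma sq_le_power16: "2 \<le> r \<Longrightarrow> 32 * r\<^sup>2 \<le> (2::nat) ^ (4 * r)"
proof (induction r rule: nat_induct_at_least)
  case base
  show ?case by (simp add: power2_eq_square)
next
  case (Suc r)
  have "(Suc r)\<^sup>2 \<le> 16 * r\<^sup>2"
  proof -
    have "Suc r \<le> 4 * r" using Suc.hyps by simp
    then have "(Suc r)\<^sup>2 \<le> (4 * r)\<^sup>2" by (rule power_mono) simp
    then show ?thesis by (simp add: power_mult_distrib)
  qed
  moreover have "(2::nat) ^ (4 * Suc r) = 16 * 2 ^ (4 * r)" by (simp add: power_add)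
  ultimately show ?case using Suc.IH by linarith
qed

text \<open>A bound for fixed \<open>n\<close>. Of the asymptotic inequalities, \<open>E1\<close>
  serves the case of large \<open>q 1\<close>; \<open>E3\<close> keeps the history below half of the
  vertices, and \<open>E2\<close> keeps the expected number of colour 1 neighbours of a vertex in it
  below 1/2.\<close>

lemma prob_not_percolates_supercritical:
  fixes q :: "nat \<Rightarrow> real" and l :: real
  assumes r: "2 \<le> r" and q: "\<And>s. s \<in> {1..r} \<Longrightarrow> 0 \<le> q s \<and> q s \<le> 1"
    and mono: "mono_on {1..r} q" and n: "2 \<le> n" and l_def: "l = ln (real n)"
    and P1: "C_const r * l / real n \<le> q 1"
    and P: "\<And>i. i \<in> {2..r} \<Longrightarrow> C_const r / (real n * l ^ (i - 1)) \<le> (\<Prod>j\<in>{1..i}. q j)"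
    and rl: "real r \<le> ln l" and l1: "1 \<le> l"
    and E1: "6 * l ^ 2 \<le> exp (l / 2)"
    and E2: "(l ^ 2 + 1) * exp (- (3 * l / (8 * ln l))) \<le> 1 / 2"
    and E3: "2 * (l ^ 2 + 1) * exp (l / 16) \<le> exp l"
  shows "measure_pmf.prob (indicator_pmf n r q) {w. \<not> percolates {1..n} r (edges_of w)}
    \<le> exp (- (exp (l / (16 * ln l)) / 2)) + 1 / real n"
proof -
  let ?pr = "\<lambda>Q. measure_pmf.prob (indicator_pmf n r q) {w. Q w}"
  have n0: "0 < real n" "0 < n" and r1: "1 \<le> r" and r0: "0 < real r" using n r by auto
  have expl: "exp l = real n" using n0 by (simp add: l_def)
  have lnl: "0 < ln l" using rl r0 by linarith
  have q1: "0 \<le> q 1" "q 1 \<le> 1" using q[of 1] r by auto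
  have qmin: "q 1 \<le> q s" if "s \<in> {1..r}" for s using mono that r by (auto simp: mono_on_def)
  have rn: "r \<le> n"
  proof -
    have "real r \<le> l" using rl ln_le_minus_one[of l] l1 by linarith
    also have "\<dots> \<le> real n" unfolding l_def using n0 ln_le_minus_one[of "real n"] by linarith
    finally show ?thesis by simp
  qed
  have C24: "2 ^ (2 * r + 4) \<le> C_const r"
  proof (rule C_const_ge[OF r])
    have "8 * r * 2 \<le> 8 * r\<^sup>2" using r by (simp add: power2_eq_square)
    then show "2 * r + 4 \<le> 8 * r\<^sup>2" using r by linarith
  qed
  have C1: "C_const r * ln (real n) \<le> real n * q 1"
    using P1 n0 by (simp add: l_def field_simps)
  have stuck: "?pr (\<lambda>w. \<exists>S. k\<^sub>0 \<le> card S \<and> stuck {1..n} r (edges_of w) S) \<le> 1 / real n"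
    if k0: "1 \<le> k\<^sub>0" and small: "\<And>k. k\<^sub>0 \<le> k \<Longrightarrow> real k * q 1 < 1 \<Longrightarrow>
      6 * real k * l * 2 ^ r \<le> real n * (\<Prod>s\<in>{1..r}. min 1 (real k * q s))" for k\<^sub>0
  proof (rule stuck_bound[of n r k\<^sub>0 q "C_const r", OF n rn r1 k0 q qmin C24 C1])
    fix k assume k: "k\<^sub>0 \<le> k" "real k * q 1 < 1"
    have "6 * real k * l \<le> real n * ((\<Prod>s\<in>{1..r}. min 1 (real k * q s)) / 2 ^ r)"
      using small[OF k] by (simp add: le_divide_eq)
    also have "\<dots> \<le> real n * (\<Prod>s\<in>{1..r}. 1 - (1 - q s) ^ k)"
      using prod_half_min[of "{1..r}" q k] q by (intro mult_left_mono) auto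
    finally show "6 * real k * ln (real n) \<le> real n * (\<Prod>s\<in>{1..r}. 1 - (1 - q s) ^ k)"
      by (simp add: l_def)
  qed
  show ?thesis
  proof (cases "q 1 \<le> exp (- (l / (2 * real r)))")
    case False
    \<comment> \<open>Here every colour has probability above \<open>n^(-1 / (2 * r))\<close>, so
      \<open>n * (k * q 1)^r >= k * sqrt n\<close>, which exceeds \<open>6 * k * l * 2^r\<close>
      because \<open>2^r <= l\<close>. A singleton is spanned, so nothing needs to be grown.\<close>
    have "?pr (\<lambda>w. \<exists>S. 1 \<le> card S \<and> stuck {1..n} r (edges_of w) S) \<le> 1 / real n"
    proof (rule stuck)
      fix k :: nat assume k: "1 \<le> k" "real k * q 1 < 1"
      have "(2::real) ^ r \<le> exp 1 ^ r" using exp_ge_add_one_self[of 1] by (intro power_mono) auto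
      also have "\<dots> = exp (real r)" by (simp add: exp_of_nat_mult[symmetric])
      also have "\<dots> \<le> exp (ln l)" using rl by simp
      also have "\<dots> = l" using l1 by simp
      finally have "6 * real k * l * 2 ^ r \<le> 6 * real k * l * l" using l1 by (intro mult_left_mono) auto
      also have "\<dots> = real k * (6 * l ^ 2)" by (simp add: power2_eq_square)
      also have "\<dots> \<le> real k * exp (l / 2)" using E1 by (intro mult_left_mono) auto
      also have "\<dots> = real n * (real k * exp (- (l / 2)))"
        by (simp add: expl[symmetric] exp_add[symmetric])
      also have "exp (- (l / 2)) = exp (- (l / (2 * real r))) ^ r"
        using r0 by (simp add: exp_of_nat_mult[symmetric])
      also have "real n * (real k * exp (- (l / (2 * real r))) ^ r) \<le> real n * (real k ^ r * q 1 ^ r)"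
      proof (intro mult_left_mono mult_mono power_mono)
        show "real k \<le> real k ^ r" using k r by (intro self_le_power) auto
      qed (use False in auto)
      also have "real k ^ r * q 1 ^ r = (\<Prod>s\<in>{1..r}. real k * q 1)" by (simp add: power_mult_distrib)
      also have "real n * (\<Prod>s\<in>{1..r}. real k * q 1) \<le> real n * (\<Prod>s\<in>{1..r}. min 1 (real k * q s))"
        using k(2) q1 qmin by (intro mult_left_mono prod_mono) (auto intro!: mult_left_mono)
      finally show "6 * real k * l * 2 ^ r \<le> real n * (\<Prod>s\<in>{1..r}. min 1 (real k * q s))" .
    qed simp
    moreover have "?pr (\<lambda>w. \<not> (\<exists>S\<subseteq>{1..n}. spanned r (edges_of w) S \<and> card S = 1)) = 0"
    proof -
      have "\<exists>S\<subseteq>{1..n}. spanned r (edges_of w) S \<and> card S = 1" for w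
        using n by (intro exI[of _ "{1}"]) (auto intro: spanned.single)
      then show ?thesis by simp
    qed
    ultimately show ?thesis using prob_not_percolates_le[of n r q 1]
      by (smt (verit) exp_gt_zero)
  next
    case True
    \<comment> \<open>From size \<open>l\<^sup>2\<close> on, the minimum in
      \<open>growth_lower_bound\<close> equals \<open>l\<close>, and the union bound over stuck sets
      applies.\<close>
    define K where "K = nat \<lceil>l ^ 2\<rceil>"
    \<comment> \<open>About \<open>n^(1 / (8 * r))\<close> trials: more than the inverse success
      probability \<open>n^(1 / (16 * r))\<close>, yet few enough for the explored set to have low
      density in colour 1.\<close>
    define T where "T = nat \<lfloor>exp (l / (8 * real r))\<rfloor>"
    have K: "l ^ 2 \<le> real K" "real K \<le> l ^ 2 + 1" "1 \<le> K"
    proof -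
      show "l ^ 2 \<le> real K" unfolding K_def by (rule real_nat_ceiling_ge)
      show "real K \<le> l ^ 2 + 1" unfolding K_def using l1 by (simp add: of_nat_ceiling)
      have "1 \<le> l ^ 2" using l1 by simp
      then have "1 \<le> real K" using \<open>l ^ 2 \<le> real K\<close> by linarith
      then show "1 \<le> K" by simp
    qed
    have e1: "1 \<le> exp (l / (8 * real r))" using l1 r0 by simp
    have T: "real T \<le> exp (l / (8 * real r))" "exp (l / (8 * real r)) / 2 \<le> real T" "1 \<le> T"
    proof -
      show "real T \<le> exp (l / (8 * real r))" unfolding T_def by simp
      show "1 \<le> T" unfolding T_def using e1 by (simp add: le_nat_floor)
      then have "1 \<le> real T" by simp
      moreover have "real T = of_int \<lfloor>exp (l / (8 * real r))\<rfloor>" unfolding T_def by simp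
      ultimately show "exp (l / (8 * real r)) / 2 \<le> real T" by linarith
    qed
    have TK: "real (T * K) \<le> exp (l / (8 * real r)) * (l ^ 2 + 1)"
      using T K by (simp add: mult_mono)
    have H1: "2 * (T * K) \<le> n"
    proof -
      have "exp (l / (8 * real r)) \<le> exp (l / 16)"
      proof -
        have "16 \<le> 8 * real r" using r by simp
        then have "l / (8 * real r) \<le> l / 16" using l1 by (intro divide_left_mono) auto
        then show ?thesis by simp
      qed
      then have "real (T * K) \<le> exp (l / 16) * (l ^ 2 + 1)"
        by (intro order.trans[OF TK] mult_right_mono) auto
      then have "real (2 * (T * K)) \<le> 2 * (exp (l / 16) * (l ^ 2 + 1))" by simp
      also have "\<dots> = 2 * (l ^ 2 + 1) * exp (l / 16)" by (simp only: mult_ac)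
      also have "\<dots> \<le> real n" using E3 expl by simp
      finally have "real (2 * (T * K)) \<le> real n" .
      then show ?thesis by (simp only: of_nat_le_iff)
    qed
    \<comment> \<open>The exponents combine to \<open>1/8 - 1/2 = - 3/8\<close>, in units of
      \<open>l / r\<close>. As \<open>r <= ln l\<close>, the decay still beats the polynomial factor
      \<open>l\<^sup>2 + 1\<close>.\<close>
    have H2: "real (T * K) * q 1 \<le> 1 / 2"
    proof -
      have "real (T * K) * q 1 \<le> (exp (l / (8 * real r)) * (l ^ 2 + 1)) * exp (- (l / (2 * real r)))"
        using TK True q1 by (intro mult_mono) auto
      also have "\<dots> = (l ^ 2 + 1) * (exp (l / (8 * real r)) * exp (- (l / (2 * real r))))" by simp
      also have "exp (l / (8 * real r)) * exp (- (l / (2 * real r))) = exp (- (3 * l / (8 * real r)))"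
        using r0 by (simp add: exp_add[symmetric] field_simps)
      also have "(l ^ 2 + 1) * \<dots> \<le> (l ^ 2 + 1) * exp (- (3 * l / (8 * ln l)))"
        using rl r0 l1 lnl by (intro mult_left_mono) (auto intro!: divide_left_mono)
      also have "\<dots> \<le> 1 / 2" by (rule E2)
      finally show ?thesis .
    qed
    have "?pr (\<lambda>w. \<not> (\<exists>S\<subseteq>{1..n}. spanned r (edges_of w) S \<and> card S = K))
      \<le> exp (- (real T * exp (- (2 * real r * l / 2 ^ (4 * r)))))"
      by (rule growth_phase[OF r q mono n0(2) l1 P1 P K(3,2) T(3) H1 H2])
    also have "\<dots> \<le> exp (- (exp (l / (16 * ln l)) / 2))"
    proof -
      have "real (32 * r\<^sup>2) \<le> real (2 ^ (4 * r))" using sq_le_power16[OF r] by (simp only: of_nat_le_iff)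
      then have "2 * real r * (16 * real r) \<le> 2 ^ (4 * r)" by (simp add: power2_eq_square)
      then have "2 * real r / 2 ^ (4 * r) \<le> 1 / (16 * real r)" using r0 by (simp add: field_simps)
      then have "l * (2 * real r / 2 ^ (4 * r)) \<le> l * (1 / (16 * real r))"
        using l1 by (intro mult_left_mono) auto
      then have e2: "2 * real r * l / 2 ^ (4 * r) \<le> l / (16 * real r)" by (simp add: mult_ac)
      have "exp (l / (16 * ln l)) / 2 \<le> exp (l / (16 * real r)) / 2"
        using rl r0 l1 lnl by (auto intro!: divide_left_mono)
      also have "\<dots> = exp (l / (8 * real r)) / 2 * exp (- (l / (16 * real r)))"
        using r0 by (simp add: exp_add[symmetric] field_simps)
      also have "\<dots> \<le> real T * exp (- (2 * real r * l / 2 ^ (4 * r)))"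
        using T(2) e2 by (intro mult_mono) auto
      finally show ?thesis by simp
    qed
    finally have "?pr (\<lambda>w. \<not> (\<exists>S\<subseteq>{1..n}. spanned r (edges_of w) S \<and> card S = K))
      \<le> exp (- (exp (l / (16 * ln l)) / 2))" .
    moreover have "?pr (\<lambda>w. \<exists>S. K \<le> card S \<and> stuck {1..n} r (edges_of w) S) \<le> 1 / real n"
    proof (rule stuck[OF K(3)])
      fix k assume k: "K \<le> k" "real k * q 1 < 1"
      have kl: "l ^ 2 \<le> real k" using K(1) k(1) by linarith
      then have "l * l \<le> real k" by (simp add: power2_eq_square)
      then have kl': "l \<le> real k / l" using l1 by (simp add: le_divide_eq)
      have "l * 1 \<le> l * l" using l1 by (intro mult_left_mono) auto
      then have lk: "l \<le> real k" using \<open>l * l \<le> real k\<close> by linarith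
      have "C_const r * min (real k / l) l \<le> real n * growth q r k"
        using q C_const_pos[of r] lk by (intro growth_lower_bound(2)[OF r1 _ mono n0(2) l1 _ P1 P]) auto
      then have g: "C_const r * l \<le> real n * growth q r k" using kl' by (simp add: min_def split: if_splits)
      have "2 ^ (r + 3) \<le> C_const r"
      proof -
        have "(2::real) ^ (r + 3) \<le> 2 ^ (2 * r + 4)" by (intro power_increasing) auto
        then show ?thesis using C24 by linarith
      qed
      then have "2 ^ r * 8 \<le> C_const r" unfolding power_add by simp
      moreover have "(0::real) \<le> 2 ^ r" by simp
      ultimately have "6 * 2 ^ r \<le> C_const r" by linarith
      then have "6 * 2 ^ r * (real k * l) \<le> C_const r * (real k * l)"
        using l1 by (intro mult_right_mono) auto
      also have "\<dots> = real k * (C_const r * l)" by simp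
      also have "\<dots> \<le> real k * (real n * growth q r k)" using g by (intro mult_left_mono) auto
      also have "\<dots> = real n * (\<Prod>s\<in>{1..r}. min 1 (real k * q s))"
      proof -
        have "(\<Prod>s\<in>{1..r}. min 1 (real k * q s)) = min 1 (real k * q 1) * (\<Prod>s\<in>{2..r}. min 1 (real k * q s))"
          using r by (subst prod.atLeast_Suc_atMost[of 1]) (auto simp: numeral_2_eq_2)
        then show ?thesis using k(2) by (simp add: growth_def)
      qed
      finally show "6 * real k * l * 2 ^ r \<le> real n * (\<Prod>s\<in>{1..r}. min 1 (real k * q s))"
        by (simp add: mult_ac)
    qed
    ultimately show ?thesis using prob_not_percolates_le[of n r q K] by linarith
  qed
qed

section \<open>The subcritical regime\<close>

text \<open>The term of index \<open>m\<close> in the exponential series at \<open>m\<close> is at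
  most the whole sum.\<close>

lemma power_le_exp_mult_fact: "real m ^ m \<le> exp (real m) * fact m"
proof -
  let ?f = "\<lambda>k. real m ^ k /\<^sub>R fact k"
  have "sum ?f {m} \<le> suminf ?f"
    using summable_exp_generic[of "real m"] by (intro sum_le_suminf) auto
  then have "inverse (fact m) * real m ^ m \<le> exp (real m)"
    unfolding exp_def by simp
  then have "fact m * (inverse (fact m) * real m ^ m) \<le> fact m * exp (real m)"
    by (intro mult_left_mono) auto
  moreover have "fact m * (inverse (fact m) * real m ^ m) = real m ^ m"
    unfolding mult.assoc[symmetric] by simp
  ultimately show ?thesis by (simp only: mult.commute)
qed

lemma binomial_le_exp:
  assumes "1 \<le> m"
  shows "real (N choose m) \<le> (3 * real N / real m) ^ m"
proof -
  have m: "0 < real m ^ m" using assms by simp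
  have "real ((N choose m) * fact m) \<le> real (N ^ m)"
    using binomial_fact_pow[of N m] by (simp only: of_nat_le_iff)
  then have "real (N choose m) * fact m \<le> real N ^ m" by simp
  then have "(real (N choose m) * fact m) * real m ^ m \<le> real N ^ m * (exp 1 ^ m * fact m)"
    using power_le_exp_mult_fact[of m] by (intro mult_mono) (auto simp: exp_of_nat_mult[symmetric])
  also have "\<dots> \<le> real N ^ m * (3 ^ m * fact m)"
    using exp_le by (intro mult_left_mono mult_right_mono power_mono) auto
  finally have "fact m * (real (N choose m) * real m ^ m) \<le> fact m * (3 ^ m * real N ^ m)"
    by (simp only: mult_ac)
  then have "real (N choose m) * real m ^ m \<le> 3 ^ m * real N ^ m"
    by (rule mult_left_le_imp_le) simp
  then have "real (N choose m) \<le> (3 ^ m * real N ^ m) / real m ^ m"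
    using m by (simp add: pos_le_divide_eq)
  then show ?thesis by (simp add: power_divide power_mult_distrib)
qed

lemma card_vertex_pairs: "finite S \<Longrightarrow> card (vertex_pairs S) = card S choose 2"
  unfolding vertex_pairs_def by (simp add: n_subsets)

text \<open>Spanning trees are counted as arbitrary sets of \<open>k - 1\<close> pairs, which costs only a factor \<open>O(1) ^ k\<close> per colour.\<close>

lemma prob_spanned_le:
  assumes i: "i \<le> r" and q: "\<And>s. s \<in> {1..r} \<Longrightarrow> 0 \<le> q s \<and> q s \<le> 1" and S: "S \<subseteq> {1..n}"
  shows "measure_pmf.prob (indicator_pmf n r q) {w. spanned r (edges_of w) S}
    \<le> (\<Prod>s\<in>{1..i}. real ((card S choose 2) choose (card S - 1)) * q s ^ (card S - 1))"
proof -
  let ?pr = "\<lambda>Q. measure_pmf.prob (indicator_pmf n r q) {w. Q w}"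
  define m where "m = card S - 1"
  define \<T> where "\<T> = {T. T \<subseteq> vertex_pairs S \<and> card T = m}"
  have fS: "finite S" using S finite_subset by auto
  have fV: "finite (vertex_pairs S)" using fS by (rule finite_vertex_pairs)
  have f\<T>: "finite \<T>" unfolding \<T>_def using fV by simp
  have "?pr (\<lambda>w. spanned r (edges_of w) S) \<le> ?pr (\<lambda>w. \<forall>s\<in>{1..i}. \<exists>T\<in>\<T>. \<forall>e\<in>T. w (s, e))"
  proof (intro prob_mono ballI)
    fix w s assume sp: "spanned r (edges_of w) S" and s: "s \<in> {1..i}"
    let ?F = "{e \<in> edges_of w s. e \<in> vertex_pairs S}"
    have "m \<le> card ?F" using spanned_card_edges[OF sp, of s] s i by (simp add: m_def)
    then obtain T where T: "T \<subseteq> ?F" "card T = m" by (rule obtain_subset_with_card_n)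
    then show "\<exists>T\<in>\<T>. \<forall>e\<in>T. w (s, e)"
      by (intro bexI[of _ T]) (auto simp: \<T>_def edges_of_def)
  qed
  also have "\<dots> = (\<Prod>s\<in>{1..i}. ?pr (\<lambda>w. \<exists>T\<in>\<T>. \<forall>e\<in>T. w (s, e)))"
    using i by (intro prob_indicator_colours determined_by_bex determined_by_ball determined_by_coordinate) auto
  also have "\<dots> \<le> (\<Prod>s\<in>{1..i}. real ((card S choose 2) choose m) * q s ^ m)"
  proof (intro prod_mono conjI)
    fix s assume s: "s \<in> {1..i}"
    have "?pr (\<lambda>w. \<exists>T\<in>\<T>. \<forall>e\<in>T. w (s, e)) \<le> (\<Sum>T\<in>\<T>. ?pr (\<lambda>w. \<forall>e\<in>T. w (s, e)))"
      using f\<T> by (rule prob_union_bound)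
    also have "\<dots> = (\<Sum>T\<in>\<T>. q s ^ m)"
    proof (rule sum.cong[OF refl])
      fix T assume T: "T \<in> \<T>"
      have "?pr (\<lambda>w. \<forall>x\<in>Pair s ` T. w x) = q s ^ card (Pair s ` T)"
      proof (rule prob_indicator_all)
        show "finite (Pair s ` T)" using T fV by (auto simp: \<T>_def intro: finite_subset)
        show "Pair s ` T \<subseteq> coloured_pairs n r"
          using T s i S by (auto simp: \<T>_def coloured_pairs_def vertex_pairs_def)
      qed (use s i q in auto)
      also have "card (Pair s ` T) = m" using T by (simp add: card_image inj_on_def \<T>_def)
      finally show "?pr (\<lambda>w. \<forall>e\<in>T. w (s, e)) = q s ^ m" by simp
    qed
    also have "\<dots> = real ((card S choose 2) choose m) * q s ^ m"
      using fV fS by (simp add: \<T>_def n_subsets card_vertex_pairs)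
    finally show "?pr (\<lambda>w. \<exists>T\<in>\<T>. \<forall>e\<in>T. w (s, e)) \<le> real ((card S choose 2) choose m) * q s ^ m" .
  qed simp
  finally show ?thesis unfolding m_def .
qed

text \<open>For sizes \<open>k\<close> between \<open>L\<close> and \<open>2 * L\<close> the
  expected number of spanned sets is at most \<open>n\<close> times the power \<open>k - 1\<close>
  of a quantity of order \<open>n * k^(i-1) * P\<^sub>i\<close>. This base is small because
  \<open>k\<close> is of order \<open>l\<close>, and the exponent, at least \<open>L - 1\<close>,
  makes the total about \<open>l / n\<close>.\<close>

lemma prob_percolates_subcritical:
  fixes q :: "nat \<Rightarrow> real" and l :: real
  assumes r: "2 \<le> r" and q: "\<And>s. s \<in> {1..r} \<Longrightarrow> 0 \<le> q s \<and> q s \<le> 1"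
    and n: "2 \<le> n" and l_def: "l = ln (real n)" and l2: "2 \<le> l"
    and i: "i \<in> {2..r}" and P: "(\<Prod>j\<in>{1..i}. q j) \<le> 1 / (C_const r * real n * l ^ (i - 1))"
  shows "measure_pmf.prob (indicator_pmf n r q) {w. percolates {1..n} r (edges_of w)}
    \<le> 16 * (l + 2) / real n"
proof -
  let ?pr = "\<lambda>Q. measure_pmf.prob (indicator_pmf n r q) {w. Q w}"
  define L where "L = nat \<lceil>l\<rceil>"
  have n0: "0 < real n" using n by simp
  have expl: "exp l = real n" using n0 by (simp add: l_def)
  have L: "l \<le> real L" "real L \<le> l + 1"
    unfolding L_def using l2 real_nat_ceiling_ge[of l] by (auto simp: of_nat_ceiling)
  have L2: "2 \<le> L" using L(1) l2 by linarith
  have Ln: "L \<le> n"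
  proof -
    have "l \<le> real n" unfolding l_def using n0 ln_le_minus_one[of "real n"] by linarith
    then show ?thesis unfolding L_def by (simp add: nat_le_iff ceiling_le_iff)
  qed
  have Pi0: "0 \<le> (\<Prod>j\<in>{1..i}. q j)" using q i by (intro prod_nonneg) auto
  have ir: "i \<le> r" "2 \<le> i" using i by auto
  let ?B = "\<lambda>k. {S. S \<subseteq> {1..n} \<and> card S = k}"
  have term_le: "real (n choose k) * (\<Prod>s\<in>{1..i}. real ((k choose 2) choose (k - 1)) * q s ^ (k - 1))
      \<le> real n * (1 / 16) ^ (L - 1)" if k: "k \<in> {L..2 * L}" for k
  proof -
    define m where "m = k - 1"
    have m: "1 \<le> m" "k = Suc m" "L - 1 \<le> m" using k L2 by (auto simp: m_def)
    have k2m: "real k \<le> 2 * real m" using m by simp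
    have k0: "0 < real k" using m by simp
    \<comment> \<open>One factor \<open>n\<close> is split off so that the exponent becomes
      \<open>m = k - 1\<close>, matching the number of tree edges; the rest then merges into a
      single \<open>m\<close>-th power.\<close>
    have nk: "real (n choose k) \<le> real n * (6 * real n / real k) ^ m"
    proof -
      have "Suc m * (n choose Suc m) = n * ((n - 1) choose m)"
        by (rule binomial_absorption)
      then have "n choose k \<le> n * ((n - 1) choose m)" unfolding m(2) by (metis le_add1 mult_Suc)
      also have "\<dots> \<le> n * (n choose m)" by (intro mult_le_mono2 binomial_right_mono) simp
      finally have "real (n choose k) \<le> real (n * (n choose m))" by (simp only: of_nat_le_iff)
      also have "\<dots> \<le> real n * (3 * real n / real m) ^ m"
        using binomial_le_exp[OF m(1), of n] by (simp add: mult_left_mono)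
      also have "\<dots> \<le> real n * (6 * real n / real k) ^ m"
      proof (intro mult_left_mono power_mono)
        show "3 * real n / real m \<le> 6 * real n / real k"
          using k2m k0 m n0 by (simp add: field_simps)
      qed auto
      finally show ?thesis .
    qed
    have trees: "real ((k choose 2) choose m) \<le> (2 * real k) ^ m"
    proof -
      have "real ((k choose 2) choose m) \<le> (3 * real (k choose 2) / real m) ^ m"
        using m by (intro binomial_le_exp)
      also have "\<dots> \<le> (2 * real k) ^ m"
      proof (intro power_mono)
        have "2 * (k choose 2) \<le> k * m" unfolding m(2) choose_two by simp
        then have "2 * real (k choose 2) \<le> real k * real m"
          by (metis of_nat_le_iff of_nat_mult of_nat_numeral)
        then have "3 * real (k choose 2) \<le> 2 * (real k * real m)"
          using of_nat_0_le_iff[of "k choose 2", where 'a = real] by linarith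
        then show "3 * real (k choose 2) / real m \<le> 2 * real k"
          using m by (simp only: pos_divide_le_eq mult.assoc of_nat_0_less_iff Suc_le_eq One_nat_def)
      qed auto
      finally show ?thesis .
    qed
    \<comment> \<open>With \<open>k <= 4 * l\<close> the powers of \<open>l\<close> cancel and leave
      at most \<open>2^(3 * r + 1) / C_const r\<close>. The target 1/16 is chosen below
      \<open>exp (- 2)\<close>, so that \<open>L >= l\<close> factors give
      \<open>1 / n^2\<close>.\<close>
    have base: "6 * real n / real k * ((2 * real k) ^ i * (\<Prod>j\<in>{1..i}. q j)) \<le> 1 / 16"
    proof -
      obtain i' where i': "i = Suc i'" using ir by (cases i) auto
      have kl: "real k \<le> 4 * l"
      proof -
        have "real k \<le> real (2 * L)" using k by (simp only: of_nat_le_iff) simp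
        then show ?thesis using L l2 by simp
      qed
      have C: "2 ^ (3 * r + 5) \<le> C_const r"
      proof (rule C_const_ge[OF r])
        have "8 * r * 2 \<le> 8 * r\<^sup>2" using r by (simp add: power2_eq_square)
        then show "3 * r + 5 \<le> 8 * r\<^sup>2" using r by linarith
      qed
      have C0: "0 < C_const r" by (rule C_const_pos)
      have "6 * real n / real k * ((2 * real k) ^ i * (\<Prod>j\<in>{1..i}. q j))
        = 6 * 2 ^ i * real n * real k ^ (i - 1) * (\<Prod>j\<in>{1..i}. q j)"
        unfolding i' using k0 by (simp add: power_mult_distrib)
      also have "\<dots> \<le> 6 * 2 ^ i * real n * (4 * l) ^ (i - 1) * (1 / (C_const r * real n * l ^ (i - 1)))"
        using P kl Pi0 by (intro mult_mono power_mono mult_left_mono) auto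
      also have "\<dots> = 6 * 2 ^ i * 4 ^ (i - 1) / C_const r"
        using n0 l2 by (simp add: power_mult_distrib)
      also have "\<dots> \<le> (8 * 2 ^ i * 4 ^ (i - 1)) / C_const r"
        using C0 by (intro divide_right_mono mult_right_mono) auto
      also have "8 * 2 ^ i * (4::real) ^ (i - 1) = 2 ^ (3 + i + 2 * (i - 1))"
        by (simp add: power_add power_mult)
      also have "\<dots> / C_const r \<le> 2 ^ (3 * r + 1) / C_const r"
        using C0 ir by (intro divide_right_mono power_increasing) auto
      also have "\<dots> \<le> 1 / 16"
        using C C0 unfolding power_add by (simp add: field_simps)
      finally show ?thesis .
    qed
    have "(\<Prod>s\<in>{1..i}. real ((k choose 2) choose m) * q s ^ m) = real ((k choose 2) choose m) ^ i * (\<Prod>j\<in>{1..i}. q j) ^ m"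
      by (simp add: prod.distrib prod_power_distrib)
    also have "\<dots> \<le> ((2 * real k) ^ m) ^ i * (\<Prod>j\<in>{1..i}. q j) ^ m"
      using trees Pi0 by (intro mult_right_mono power_mono) auto
    also have "\<dots> = ((2 * real k) ^ i * (\<Prod>j\<in>{1..i}. q j)) ^ m"
      by (simp add: power_mult_distrib power_mult[symmetric] mult.commute)
    finally have "real (n choose k) * (\<Prod>s\<in>{1..i}. real ((k choose 2) choose m) * q s ^ m)
      \<le> real n * (6 * real n / real k) ^ m * ((2 * real k) ^ i * (\<Prod>j\<in>{1..i}. q j)) ^ m"
      using nk q ir by (intro mult_mono) (auto intro!: prod_nonneg)
    also have "\<dots> = real n * (6 * real n / real k * ((2 * real k) ^ i * (\<Prod>j\<in>{1..i}. q j))) ^ m"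
      by (simp only: power_mult_distrib mult.assoc)
    also have "\<dots> \<le> real n * (1 / 16) ^ m"
      using base Pi0 by (intro mult_left_mono power_mono) auto
    also have "\<dots> \<le> real n * (1 / 16) ^ (L - 1)"
      using m(3) by (intro mult_left_mono power_decreasing) auto
    finally show ?thesis by (simp add: m_def)
  qed
  have "?pr (\<lambda>w. percolates {1..n} r (edges_of w))
    \<le> ?pr (\<lambda>w. \<exists>k\<in>{L..2 * L}. \<exists>S\<in>?B k. spanned r (edges_of w) S)"
  proof (rule prob_mono)
    fix w assume "percolates {1..n} r (edges_of w)"
    then have "spanned r (edges_of w) {1..n}" by (intro percolates_imp_spanned) auto
    then obtain S where "S \<subseteq> {1..n}" "spanned r (edges_of w) S" "L \<le> card S" "card S \<le> 2 * L"
      using spanned_intermediate[of r "edges_of w" "{1..n}" L] L2 Ln by auto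
    then show "\<exists>k\<in>{L..2 * L}. \<exists>S\<in>?B k. spanned r (edges_of w) S"
      by (intro bexI[of _ "card S"] bexI[of _ S]) auto
  qed
  also have "\<dots> \<le> (\<Sum>k\<in>{L..2 * L}. ?pr (\<lambda>w. \<exists>S\<in>?B k. spanned r (edges_of w) S))"
    by (intro prob_union_bound) simp
  also have "\<dots> \<le> (\<Sum>k\<in>{L..2 * L}. \<Sum>S\<in>?B k. ?pr (\<lambda>w. spanned r (edges_of w) S))"
    by (intro sum_mono prob_union_bound) simp
  also have "\<dots> \<le> (\<Sum>k\<in>{L..2 * L}. \<Sum>S\<in>?B k.
      \<Prod>s\<in>{1..i}. real ((k choose 2) choose (k - 1)) * q s ^ (k - 1))"
  proof (intro sum_mono)
    fix k S assume "S \<in> ?B k"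
    then show "?pr (\<lambda>w. spanned r (edges_of w) S)
      \<le> (\<Prod>s\<in>{1..i}. real ((k choose 2) choose (k - 1)) * q s ^ (k - 1))"
      using prob_spanned_le[where S = S and n = n, OF ir(1) q] by auto
  qed
  also have "\<dots> = (\<Sum>k\<in>{L..2 * L}. real (n choose k) *
      (\<Prod>s\<in>{1..i}. real ((k choose 2) choose (k - 1)) * q s ^ (k - 1)))"
    by (simp add: n_subsets)
  also have "\<dots> \<le> (\<Sum>k\<in>{L..2 * L}. real n * (1 / 16) ^ (L - 1))"
    using term_le by (rule sum_mono)
  also have "\<dots> = real (L + 1) * (real n * (1 / 16) ^ (L - 1))" by simp
  also have "\<dots> \<le> (l + 2) * (real n * (16 / real n ^ 2))"
  proof (intro mult_mono mult_left_mono)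
    have "(1 / 16 :: real) ^ (L - 1) = 16 * (1 / 16) ^ L"
      using L2 by (cases L) auto
    also have "(1 / 16 :: real) ^ L \<le> exp (- 2) ^ L"
    proof (intro power_mono)
      have "exp 2 = exp 1 * exp (1 :: real)" by (simp add: exp_add[symmetric])
      also have "\<dots> \<le> 3 * 3" using exp_le by (intro mult_mono) auto
      finally show "1 / 16 \<le> exp (- 2 :: real)" by (simp add: exp_minus field_simps)
    qed simp
    also have "exp (- 2 :: real) ^ L = exp (- (2 * real L))" by (simp add: exp_of_nat_mult[symmetric] mult.commute)
    also have "\<dots> \<le> exp (- (2 * l))" using L by simp
    also have "\<dots> = 1 / real n ^ 2"
      by (simp add: expl[symmetric] exp_minus exp_double divide_inverse)
    finally show "(1 / 16 :: real) ^ (L - 1) \<le> 16 / real n ^ 2" by simp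
  qed (use L l2 in auto)
  also have "\<dots> = 16 * (l + 2) / real n" using n0 by (simp add: power2_eq_square)
  finally show ?thesis .
qed

text \<open>Neighbourhoods of different vertices share pairs and are not independent. This is
  repaired by looking only at a small set \<open>A\<close>: it probably contains no colour 1 edge at
  all, and the pairs from its vertices to the outside are disjoint.\<close>

lemma prob_percolates_isolated:
  fixes q :: "nat \<Rightarrow> real" and l :: real
  assumes r: "1 \<le> r" and q: "0 \<le> q 1" "q 1 \<le> 1 / 2"
    and n: "2 \<le> n" and l_def: "l = ln (real n)" and P: "q 1 \<le> l / (100 * real n)"
  shows "measure_pmf.prob (indicator_pmf n r q) {w. percolates {1..n} r (edges_of w)}
    \<le> l * exp (- (l / 2)) + exp (- (real (nat \<lfloor>exp (l / 4)\<rfloor>) * exp (- (l / 50))))"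
proof -
  let ?pr = "\<lambda>Q. measure_pmf.prob (indicator_pmf n r q) {w. Q w}"
  \<comment> \<open>About \<open>n^(1/4)\<close> vertices: the at most \<open>sqrt n\<close> pairs
    inside carry few colour 1 edges, while each vertex lacks outside neighbours with probability at
    least \<open>n^(-1/50)\<close>, so such a vertex is likely to exist.\<close>
  define m where "m = nat \<lfloor>exp (l / 4)\<rfloor>"
  define A where "A = {1..m}"
  have n0: "0 < real n" using n by simp
  have expl: "exp l = real n" using n0 by (simp add: l_def)
  have l0: "0 \<le> l" unfolding l_def using n by simp
  have m: "real m \<le> exp (l / 4)" unfolding m_def by simp
  have mn: "m \<le> n"
  proof -
    have "exp (l / 4) \<le> exp l" using l0 by simp
    then have "real m \<le> real n" using m expl by linarith
    then show ?thesis by simp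
  qed
  have AV: "A \<subseteq> {1..n}" unfolding A_def using mn by auto
  have fA: "finite A" "card A = m" unfolding A_def by auto
  have "?pr (\<lambda>w. percolates {1..n} r (edges_of w))
    \<le> measure_pmf.prob (indicator_pmf n r q)
       ({w. \<exists>e\<in>vertex_pairs A. w (1, e)} \<union> {w. \<forall>v\<in>A. \<exists>y\<in>{1..n} - A. w (1, {v, y})})"
  proof (intro measure_pmf.finite_measure_mono subsetI)
    fix w assume "w \<in> {w. percolates {1..n} r (edges_of w)}"
    then have sp: "spanned r (edges_of w) {1..n}" by (intro percolates_imp_spanned) auto
    show "w \<in> {w. \<exists>e\<in>vertex_pairs A. w (1, e)} \<union> {w. \<forall>v\<in>A. \<exists>y\<in>{1..n} - A. w (1, {v, y})}"
    proof (rule ccontr)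
      assume neg: "w \<notin> {w. \<exists>e\<in>vertex_pairs A. w (1, e)} \<union> {w. \<forall>v\<in>A. \<exists>y\<in>{1..n} - A. w (1, {v, y})}"
      then obtain v where v: "v \<in> A" "\<forall>y\<in>{1..n} - A. \<not> w (1, {v, y})" by auto
      obtain y where y: "y \<in> {1..n}" "y \<noteq> v" "{v, y} \<in> edges_of w 1"
        using spanned_no_isolated[OF sp, of 1 v] subsetD[OF AV v(1)] r n by auto
      then have wy: "w (1, {v, y})" by (simp add: edges_of_def)
      show False
      proof (cases "y \<in> A")
        case True
        then have "{v, y} \<in> vertex_pairs A" using v(1) y(2) by (auto simp: vertex_pairs_def)
        then show False using neg wy by auto
      next
        case False
        then show False using v(2) y(1) wy by auto
      qed
    qed
  qed auto
  also have "\<dots> \<le> ?pr (\<lambda>w. \<exists>e\<in>vertex_pairs A. w (1, e)) + ?pr (\<lambda>w. \<forall>v\<in>A. \<exists>y\<in>{1..n} - A. w (1, {v, y}))"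
    by (rule measure_Un_le) auto
  also have "\<dots> \<le> l * exp (- (l / 2)) + exp (- (real m * exp (- (l / 50))))"
  proof (rule add_mono)
    have "?pr (\<lambda>w. \<exists>e\<in>vertex_pairs A. w (1, e)) \<le> (\<Sum>e\<in>vertex_pairs A. ?pr (\<lambda>w. w (1, e)))"
      using fA by (intro prob_union_bound finite_vertex_pairs)
    also have "\<dots> = (\<Sum>e\<in>vertex_pairs A. q 1)"
    proof (rule sum.cong[OF refl])
      fix e assume "e \<in> vertex_pairs A"
      then show "?pr (\<lambda>w. w (1, e)) = q 1"
        using prob_indicator_coordinate[of "(1, e)" n r q] AV q r
        by (auto simp: coloured_pairs_def vertex_pairs_def)
    qed
    also have "\<dots> = real (m choose 2) * q 1" using fA by (simp add: card_vertex_pairs)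
    also have "\<dots> \<le> exp (l / 4) ^ 2 * (l / (100 * real n))"
    proof (intro mult_mono)
      have "real (m choose 2) \<le> real (m ^ 2)"
        unfolding of_nat_le_iff choose_two by (simp add: power2_eq_square div_le_dividend le_trans[OF div_le_dividend])
      also have "\<dots> \<le> exp (l / 4) ^ 2" using m by (simp add: power_mono)
      finally show "real (m choose 2) \<le> exp (l / 4) ^ 2" .
    qed (use P q l0 in auto)
    also have "\<dots> = l * exp (- (l / 2)) / 100"
    proof -
      have "exp (l / 4) ^ 2 = exp (l / 2)" by (simp add: exp_double[symmetric])
      moreover have "exp (l / 2) / real n = exp (- (l / 2))"
        by (simp add: expl[symmetric] exp_diff[symmetric])
      moreover have "exp (l / 2) * (l / (100 * real n)) = l * (exp (l / 2) / real n) / 100"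
        by (simp add: mult.commute)
      ultimately show ?thesis by simp
    qed
    also have "\<dots> \<le> l * exp (- (l / 2))" using l0 by simp
    finally show "?pr (\<lambda>w. \<exists>e\<in>vertex_pairs A. w (1, e)) \<le> l * exp (- (l / 2))" .
  next
    have "?pr (\<lambda>w. \<forall>v\<in>A. \<exists>y\<in>{1..n} - A. w (1, {v, y}))
      = (\<Prod>v\<in>A. ?pr (\<lambda>w. \<exists>y\<in>{1..n} - A. w (1, {v, y})))"
    proof (rule prob_indicator_ball[where B = "\<lambda>v. pairs_between v ({1..n} - A)"])
      fix v
      show "determined_by (pairs_between v ({1..n} - A)) (\<lambda>w. \<exists>y\<in>{1..n} - A. w (1, {v, y}))"
        by (intro determined_by_bex determined_by_coordinate) (auto simp: pairs_between_def)
    next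
      fix u v assume "u \<in> A" "v \<in> A" "u \<noteq> v"
      then show "pairs_between u ({1..n} - A) \<inter> pairs_between v ({1..n} - A) = {}"
        by (auto simp: pairs_between_def doubleton_eq_iff)
    qed (rule fA)
    also have "\<dots> = (\<Prod>v\<in>A. 1 - (1 - q 1) ^ card ({1..n} - A))"
      using AV q r by (intro prod.cong prob_neighbour) auto
    also have "\<dots> = (1 - (1 - q 1) ^ (n - m)) ^ m"
      using AV fA by (simp add: card_Diff_subset)
    also have "\<dots> \<le> (1 - exp (- (l / 50))) ^ m"
    proof (intro power_mono)
      have "exp (- 2 * q 1) \<le> 1 - q 1"
      proof -
        have "- q 1 - 2 * (q 1)\<^sup>2 \<le> ln (1 - q 1)"
          using q by (intro ln_one_minus_pos_lower_bound) auto
        moreover have "2 * (q 1)\<^sup>2 \<le> q 1"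
          using q mult_left_mono[of "2 * q 1" 1 "q 1"] by (simp add: power2_eq_square)
        ultimately have "- 2 * q 1 \<le> ln (1 - q 1)" by linarith
        then have "exp (- 2 * q 1) \<le> exp (ln (1 - q 1))" by simp
        moreover have "exp (ln (1 - q 1)) = 1 - q 1" using q by (intro exp_ln) linarith
        ultimately show ?thesis by linarith
      qed
      then have "exp (- 2 * q 1) ^ n \<le> (1 - q 1) ^ n" by (intro power_mono) auto
      also have "\<dots> \<le> (1 - q 1) ^ (n - m)" using q by (intro power_decreasing) auto
      finally have "exp (- 2 * q 1) ^ n \<le> (1 - q 1) ^ (n - m)" .
      moreover have "exp (- 2 * q 1) ^ n = exp (- (2 * (real n * q 1)))"
        by (simp add: exp_of_nat_mult[symmetric] mult_ac)
      moreover have "2 * (real n * q 1) \<le> l / 50" using P n0 by (simp add: field_simps)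
      ultimately have "exp (- (l / 50)) \<le> (1 - q 1) ^ (n - m)" by (smt (verit) exp_le_cancel_iff)
      then show "1 - (1 - q 1) ^ (n - m) \<le> 1 - exp (- (l / 50))" by simp
      show "0 \<le> 1 - (1 - q 1) ^ (n - m)" using q by (simp add: power_le_one)
    qed
    also have "\<dots> \<le> exp (- (real m * exp (- (l / 50))))"
      using l0 by (intro one_minus_power_le_exp) auto
    finally show "?pr (\<lambda>w. \<forall>v\<in>A. \<exists>y\<in>{1..n} - A. w (1, {v, y})) \<le> exp (- (real m * exp (- (l / 50))))" .
  qed
  finally show ?thesis unfolding m_def .
qed

section \<open>Passage to the limit\<close>

lemma prob_complement_tendsto:
  assumes "(\<lambda>n. measure_pmf.prob (M n) {x. \<not> P n x}) \<longlonglongrightarrow> 0"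
  shows "(\<lambda>n. measure_pmf.prob (M n) {x. P n x}) \<longlonglongrightarrow> 1"
proof -
  have "(\<lambda>n. 1 - measure_pmf.prob (M n) {x. \<not> P n x}) \<longlonglongrightarrow> 1 - 0"
    by (intro tendsto_diff tendsto_const assms)
  then show ?thesis by (simp add: prob_not)
qed

theorem theorem3:
  fixes r :: "nat \<Rightarrow> nat" and p :: "nat \<Rightarrow> nat \<Rightarrow> real"
  assumes r_ge: "\<And>n. 2 \<le> r n"
    and r_small: "(\<lambda>n. real (r n)) \<in> o(\<lambda>n. sqrt (ln (ln (real n))))"
    and p_prob: "\<And>n i. i \<in> {1..r n} \<Longrightarrow> 0 \<le> p n i \<and> p n i \<le> 1"
    and p_mono: "\<And>n. mono_on {1..r n} (p n)"
  shows
    "((\<forall>\<^sub>F n in sequentially.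
         (\<exists>i\<in>{2..r n}. (\<Prod>j=1..i. p n j) \<le> 1 / (C_const (r n) * real n * ln (real n) ^ (i - 1)))
         \<or> p n 1 \<le> ln (real n) / (C_const (r n) * real n))
      \<longrightarrow> (\<lambda>n. measure_pmf.prob (rfold_binomial_graph n (r n) (p n))
              {E. \<not> percolates {1..n} (r n) E}) \<longlonglongrightarrow> 1)
   \<and> ((\<forall>\<^sub>F n in sequentially.
         (\<forall>i\<in>{2..r n}. (\<Prod>j=1..i. p n j) \<ge> C_const (r n) / (real n * ln (real n) ^ (i - 1)))
         \<and> p n 1 \<ge> C_const (r n) * ln (real n) / real n)
      \<longrightarrow> (\<lambda>n. measure_pmf.prob (rfold_binomial_graph n (r n) (p n))
              {E. percolates {1..n} (r n) E}) \<longlonglongrightarrow> 1)"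
proof (intro conjI impI)
  let ?l = "\<lambda>n::nat. ln (real n)"
  let ?pr = "\<lambda>n Q. measure_pmf.prob (indicator_pmf n (r n) (p n)) {w. Q w}"
  {
    assume sub: "\<forall>\<^sub>F n in sequentially.
         (\<exists>i\<in>{2..r n}. (\<Prod>j=1..i. p n j) \<le> 1 / (C_const (r n) * real n * ln (real n) ^ (i - 1)))
         \<or> p n 1 \<le> ln (real n) / (C_const (r n) * real n)"
    let ?f = "\<lambda>n. 16 * (?l n + 2) / real n"
    let ?g = "\<lambda>n. ?l n * exp (- (?l n / 2)) + exp (- (real (nat \<lfloor>exp (?l n / 4)\<rfloor>) * exp (- (?l n / 50))))"
    have l2: "\<forall>\<^sub>F n in sequentially. 2 \<le> ?l n" by real_asymp
    have half: "\<forall>\<^sub>F n::nat in sequentially. ?l n / (100 * real n) \<le> 1 / 2" by real_asymp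
    have n2: "\<forall>\<^sub>F n::nat in sequentially. 2 \<le> n" by (rule eventually_ge_at_top)
    \<comment> \<open>The double negation fits \<open>prob_complement_tendsto\<close>, which is
      applied to the event of not percolating.\<close>
    have le: "\<forall>\<^sub>F n in sequentially.
      measure_pmf.prob (rfold_binomial_graph n (r n) (p n)) {E. \<not> \<not> percolates {1..n} (r n) E} \<le> ?f n + ?g n"
      using sub l2 half n2
    proof eventually_elim
      case (elim n)
      \<comment> \<open>Which alternative holds, and for which \<open>i\<close>, may change with
        \<open>n\<close>; the sum of the two nonnegative bounds covers both.\<close>
      have f0: "0 \<le> ?f n" "0 \<le> ?g n" using elim(2) by auto
      from elim(1) have "?pr n (\<lambda>w. percolates {1..n} (r n) (edges_of w)) \<le> ?f n + ?g n"
      proof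
        assume "\<exists>i\<in>{2..r n}. (\<Prod>j=1..i. p n j) \<le> 1 / (C_const (r n) * real n * ln (real n) ^ (i - 1))"
        then obtain i where i: "i \<in> {2..r n}"
          "(\<Prod>j=1..i. p n j) \<le> 1 / (C_const (r n) * real n * ln (real n) ^ (i - 1))" by blast
        have "?pr n (\<lambda>w. percolates {1..n} (r n) (edges_of w)) \<le> ?f n"
          by (rule prob_percolates_subcritical[OF r_ge p_prob elim(4) refl elim(2) i])
        then show ?thesis using f0 by linarith
      next
        assume p1: "p n 1 \<le> ln (real n) / (C_const (r n) * real n)"
        \<comment> \<open>128 exceeds the 100 required by the bound for isolated vertices.\<close>
        have "(2::real) ^ 7 \<le> C_const (r n)"
        proof (rule C_const_ge[OF r_ge])
          have "2\<^sup>2 \<le> (r n)\<^sup>2" using r_ge[of n] by (intro power_mono) auto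
          then show "7 \<le> 8 * (r n)\<^sup>2" by simp
        qed
        then have "100 \<le> C_const (r n)" by simp
        then have "ln (real n) / (C_const (r n) * real n) \<le> ln (real n) / (100 * real n)"
          using elim(2,4) by (intro divide_left_mono mult_right_mono mult_pos_pos) auto
        then have p1': "p n 1 \<le> ln (real n) / (100 * real n)" using p1 by linarith
        have r1: "1 \<le> r n" using r_ge[of n] by linarith
        have "p n 1 \<le> 1 / 2" using p1' elim(3) by linarith
        then have "?pr n (\<lambda>w. percolates {1..n} (r n) (edges_of w)) \<le> ?g n"
          using p_prob[of 1 n] r1 p1' elim(4) by (intro prob_percolates_isolated) auto
        then show ?thesis using f0 by linarith
      qed
      then show ?case by (simp only: prob_rfold not_not)
    qed
    have lim: "(\<lambda>n. ?f n + ?g n) \<longlonglongrightarrow> 0" by real_asymp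
    have "(\<lambda>n. measure_pmf.prob (rfold_binomial_graph n (r n) (p n))
              {E. \<not> \<not> percolates {1..n} (r n) E}) \<longlonglongrightarrow> 0"
      by (rule tendsto_sandwich[OF _ le tendsto_const lim]) simp
    then show "(\<lambda>n. measure_pmf.prob (rfold_binomial_graph n (r n) (p n))
              {E. \<not> percolates {1..n} (r n) E}) \<longlonglongrightarrow> 1"
      by (rule prob_complement_tendsto)
  }
  {
    assume sup: "\<forall>\<^sub>F n in sequentially.
         (\<forall>i\<in>{2..r n}. (\<Prod>j=1..i. p n j) \<ge> C_const (r n) / (real n * ln (real n) ^ (i - 1)))
         \<and> p n 1 \<ge> C_const (r n) * ln (real n) / real n"
    let ?f = "\<lambda>n. exp (- (exp (?l n / (16 * ln (?l n))) / 2)) + 1 / real n"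
    have "\<forall>\<^sub>F n in sequentially. norm (real (r n)) \<le> 1 * norm (sqrt (ln (ln (real n))))"
      using r_small by (rule landau_o.smallD) simp
    moreover have "\<forall>\<^sub>F n::nat in sequentially. 1 \<le> ln (ln (real n))" by real_asymp
    \<comment> \<open>Once \<open>ln (ln n) >= 1\<close>, its square root is at most
      \<open>ln (ln n)\<close> itself, so \<open>r n <= ln (ln n)\<close> eventually.\<close>
    ultimately have rl: "\<forall>\<^sub>F n in sequentially. real (r n) \<le> ln (?l n)"
    proof eventually_elim
      case (elim n)
      have "sqrt (ln (?l n)) * 1 \<le> sqrt (ln (?l n)) * sqrt (ln (?l n))"
        using elim(2) by (intro mult_left_mono) auto
      also have "\<dots> = ln (?l n)" using elim(2) by simp
      finally show ?case using elim by simp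
    qed
    have l1: "\<forall>\<^sub>F n in sequentially. 1 \<le> ?l n" by real_asymp
    have E1: "\<forall>\<^sub>F n in sequentially. 6 * ?l n ^ 2 \<le> exp (?l n / 2)" by real_asymp
    have E2: "\<forall>\<^sub>F n in sequentially. (?l n ^ 2 + 1) * exp (- (3 * ?l n / (8 * ln (?l n)))) \<le> 1 / 2"
      by real_asymp
    have E3: "\<forall>\<^sub>F n in sequentially. 2 * (?l n ^ 2 + 1) * exp (?l n / 16) \<le> exp (?l n)" by real_asymp
    have n2: "\<forall>\<^sub>F n::nat in sequentially. 2 \<le> n" by (rule eventually_ge_at_top)
    have le: "\<forall>\<^sub>F n in sequentially.
      measure_pmf.prob (rfold_binomial_graph n (r n) (p n)) {E. \<not> percolates {1..n} (r n) E} \<le> ?f n"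
      using sup rl l1 E1 E2 E3 n2
    proof eventually_elim
      case (elim n)
      show ?case unfolding prob_rfold
        by (rule prob_not_percolates_supercritical[OF r_ge p_prob p_mono elim(7) refl _ _ elim(2-6)])
           (use elim(1) in auto)
    qed
    have lim: "?f \<longlonglongrightarrow> 0" by real_asymp
    have "(\<lambda>n. measure_pmf.prob (rfold_binomial_graph n (r n) (p n))
              {E. \<not> percolates {1..n} (r n) E}) \<longlonglongrightarrow> 0"
      by (rule tendsto_sandwich[OF _ le tendsto_const lim]) simp
    then show "(\<lambda>n. measure_pmf.prob (rfold_binomial_graph n (r n) (p n))
              {E. percolates {1..n} (r n) E}) \<longlonglongrightarrow> 1"
      by (rule prob_complement_tendsto)
  }
qed

end
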